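(* Let $d\ge 2$ and let $f(\vec x)=\sum_{\vec k\in\mathbb Z_+^d:\,N(\vec k)\le M}\lambda(\vec k)\prod_{s=1}^d g^{(s)}_{k(s)}(x(s))$, $M\le\infty$, where for each $s$ the functions $g^{(s)}_1,g^{(s)}_2,\dots$ are centered and orthonormal in $L_2(\mu_s)$, $\sum_{\vec k}\lambda(\vec k)^2<\infty$ (series converging in $L_2$), and $W_d[f](2)<\infty$. Let $L=[1,n(1)]\times\dots\times[1,n(d)]\cap\mathbb Z_+^d$. Then, as $\min_l n(l)\to\infty$, $$S_L[f]\xrightarrow{d}S_\infty:=\sum_{\vec k:\,N(\vec k)\le M}\lambda(\vec k)\prod_{s=1}^d\beta^{(s)}(k(s)),$$ where $\{\beta^{(s)}(j):1\le s\le d,\ j\ge1\}$ are mutually independent standard normal random variables.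
   Context: Let $(X_s,\mathcal B_s,\mu_s)$, $s=1,\dots,d$, be probability spaces and $\{\xi_i(s):i\ge1,1\le s\le d\}$ mutually independent random variables, $\xi_i(s)$ with law $\mu_s$. $|\zeta|_p=(\mathbf E|\zeta|^p)^{1/p}$; $|F|_p=|F(\xi_1(1),\dots,\xi_1(d))|_p$, $|g|_p=|g(\xi_1(s))|_p$ for $g$ on $X_s$. $N(\vec k)=\max_s k(s)$. For finite non-empty $L\subset\mathbb Z_+^d$, $S_L[f]:=|L|^{-1/2}\sum_{\vec k\in L}f(\xi_{k(1)}(1),\dots,\xi_{k(d)}(d))$. $K_R(p)$ is the smallest constant $K$ such that for all $n$, real $c_i$ and i.i.d. centered $\zeta_i$ with finite $p$-th moment, $|\sum c_i\zeta_i|_p\le K(\sum c_i^2)^{1/2}|\zeta_1|_p$. For finite $M$, $D[M]$ is the set of functions $\sum_{N(\vec k)\le M}\lambda(\vec k)\prod_s g^{(s)}_{k(s)}(x(s))$ with centered factors; $\|F\|D_p:=\inf\sum|\lambda(\vec k)|\prod_s|g^{(s)}_{k(s)}|_p$ over such (possibly infinite, $L_p$-convergent) representations; $Q_M[f]_p:=\inf_{\tilde f\in D[M]}|f-\tilde f|_p$ with minimizer $Z_M[f]$; $W_d[f](p):=\sup_L\inf_{M\ge1}[K_R^d(p)\|Z_M[f]\|D_p+|L|^{1/2}Q_M[f]_p]$. *)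

theory Defs
  imports "HOL-Probability.Probability"
begin

text \<open>Index vectors in Z_+^d with N(k) <= m (m may be infinite). Coordinates are 0..<d;
  index vectors are extensional (value 0 outside 0..<d).\<close>
definition idx :: "nat \<Rightarrow> enat \<Rightarrow> (nat \<Rightarrow> nat) set" where
  "idx d m = {k. (\<forall>s<d. 1 \<le> k s \<and> enat (k s) \<le> m) \<and> (\<forall>s. d \<le> s \<longrightarrow> k s = 0)}"

definition box_idx :: "nat \<Rightarrow> (nat \<Rightarrow> nat) \<Rightarrow> (nat \<Rightarrow> nat) set" where
  "box_idx d n = {k. (\<forall>s<d. 1 \<le> k s \<and> k s \<le> n s) \<and> (\<forall>s. d \<le> s \<longrightarrow> k s = 0)}"

definition tens :: "nat \<Rightarrow> (nat \<Rightarrow> nat \<Rightarrow> 'a \<Rightarrow> real) \<Rightarrow> (nat \<Rightarrow> nat) \<Rightarrow> (nat \<Rightarrow> 'a) \<Rightarrow> real" where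
  "tens d g k x = (\<Prod>s<d. g s (k s) (x s))"

definition lpn :: "'a measure \<Rightarrow> real \<Rightarrow> ('a \<Rightarrow> real) \<Rightarrow> real" where
  "lpn M p h = (\<integral>x. \<bar>h x\<bar> powr p \<partial>M) powr (1 / p)"

definition in_Lp :: "'a measure \<Rightarrow> real \<Rightarrow> ('a \<Rightarrow> real) \<Rightarrow> bool" where
  "in_Lp M p h \<longleftrightarrow> h \<in> borel_measurable M \<and> integrable M (\<lambda>x. \<bar>h x\<bar> powr p)"

text \<open>K_R(p): the smallest constant K with |sum c_i zeta_i|_p <= K (sum c_i^2)^(1/2) |zeta_1|_p
  for all n, real c_i and i.i.d. centered zeta_i with finite p-th moment (with common law nu,
  realized as the coordinates of the product measure nu^n).\<close>
definition KR :: "real \<Rightarrow> ennreal" where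
  "KR p = Inf {K. \<forall>(n::nat) (c::nat \<Rightarrow> real) (\<nu>::real measure).
      prob_space \<nu> \<and> sets \<nu> = sets borel \<and> integrable \<nu> (\<lambda>t. \<bar>t\<bar> powr p)
      \<and> integrable \<nu> (\<lambda>t. t) \<and> integral\<^sup>L \<nu> (\<lambda>t. t) = 0 \<longrightarrow>
      ennreal (lpn (PiM {..<n} (\<lambda>_. \<nu>)) p (\<lambda>z. \<Sum>i<n. c i * z i))
        \<le> K * ennreal (sqrt (\<Sum>i<n. (c i)\<^sup>2) * lpn \<nu> p (\<lambda>t. t))}"

definition D_rep :: "(nat \<Rightarrow> 'a measure) \<Rightarrow> nat \<Rightarrow> real \<Rightarrow> ((nat \<Rightarrow> 'a) \<Rightarrow> real)
    \<Rightarrow> ((nat \<Rightarrow> nat) \<Rightarrow> real) \<Rightarrow> (nat \<Rightarrow> nat \<Rightarrow> 'a \<Rightarrow> real) \<Rightarrow> bool" where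
  "D_rep M d p F lam g \<longleftrightarrow>
     (\<forall>s<d. \<forall>j\<ge>1. in_Lp (M s) p (g s j) \<and> integral\<^sup>L (M s) (g s j) = 0)
     \<and> in_Lp (PiM {..<d} M) p F
     \<and> (\<forall>\<epsilon>>0. \<exists>F0. finite F0 \<and> F0 \<subseteq> idx d \<infinity> \<and>
          (\<forall>G. finite G \<and> F0 \<subseteq> G \<and> G \<subseteq> idx d \<infinity> \<longrightarrow>
             lpn (PiM {..<d} M) p (\<lambda>x. F x - (\<Sum>k\<in>G. lam k * tens d g k x)) < \<epsilon>))"

definition Dnorm :: "(nat \<Rightarrow> 'a measure) \<Rightarrow> nat \<Rightarrow> real \<Rightarrow> ((nat \<Rightarrow> 'a) \<Rightarrow> real) \<Rightarrow> ennreal" where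
  "Dnorm M d p F = Inf {(\<integral>\<^sup>+ k. ennreal (\<bar>lam k\<bar> * (\<Prod>s<d. lpn (M s) p (g s (k s))))
                              \<partial>count_space (idx d \<infinity>)) | lam g. D_rep M d p F lam g}"

definition DM :: "(nat \<Rightarrow> 'a measure) \<Rightarrow> nat \<Rightarrow> real \<Rightarrow> nat \<Rightarrow> ((nat \<Rightarrow> 'a) \<Rightarrow> real) set" where
  "DM M d p m = {F. \<exists>lam g.
      (\<forall>s<d. \<forall>j\<in>{1..m}. in_Lp (M s) p (g s j) \<and> integral\<^sup>L (M s) (g s j) = 0)
      \<and> (\<forall>x\<in>space (PiM {..<d} M). F x = (\<Sum>k\<in>idx d (enat m). lam k * tens d g k x))}"

definition QM :: "(nat \<Rightarrow> 'a measure) \<Rightarrow> nat \<Rightarrow> real \<Rightarrow> nat \<Rightarrow> ((nat \<Rightarrow> 'a) \<Rightarrow> real) \<Rightarrow> real" where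
  "QM M d p m f = Inf {lpn (PiM {..<d} M) p (\<lambda>x. f x - h x) | h. h \<in> DM M d p m}"

definition ZM :: "(nat \<Rightarrow> 'a measure) \<Rightarrow> nat \<Rightarrow> real \<Rightarrow> nat \<Rightarrow> ((nat \<Rightarrow> 'a) \<Rightarrow> real)
    \<Rightarrow> ((nat \<Rightarrow> 'a) \<Rightarrow> real)" where
  "ZM M d p m f = (SOME h. h \<in> DM M d p m \<and> lpn (PiM {..<d} M) p (\<lambda>x. f x - h x) = QM M d p m f)"

definition Wd :: "(nat \<Rightarrow> 'a measure) \<Rightarrow> nat \<Rightarrow> ((nat \<Rightarrow> 'a) \<Rightarrow> real) \<Rightarrow> real \<Rightarrow> ennreal" where
  "Wd M d f p = (SUP L\<in>{L. finite L \<and> L \<noteq> {} \<and> L \<subseteq> idx d \<infinity>}.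
      INF m\<in>{1::nat..}. KR p ^ d * Dnorm M d p (ZM M d p m f)
                         + ennreal (sqrt (real (card L)) * QM M d p m f))"

definition SL :: "nat \<Rightarrow> (nat \<Rightarrow> nat \<Rightarrow> 'b \<Rightarrow> 'a) \<Rightarrow> ((nat \<Rightarrow> 'a) \<Rightarrow> real) \<Rightarrow> (nat \<Rightarrow> nat) set
    \<Rightarrow> 'b \<Rightarrow> real" where
  "SL d \<xi> f L \<omega> = (\<Sum>k\<in>L. f (restrict (\<lambda>s. \<xi> (k s) s \<omega>) {..<d})) / sqrt (real (card L))"

end

(*  A finite linear combination of the products of the g's turns S_L into a polynomial in the
    normalized column sums U_s(j) = n(s)^(-1/2) * sum_i g_j(xi_i(s)), multilinear over the columns
    s < d. Columns are independent, so they may be replaced by Gaussian columns one at a time: given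
    the other columns, the polynomial is a linear form in column s, and the one-dimensional central
    limit theorem gives convergence of its characteristic function, pointwise in the coefficients
    and hence, by equicontinuity, uniformly on bounded sets. The general f follows by L2 truncation,
    since the normalized sums of distinct products are orthonormal for every box, and Levy's
    continuity theorem turns convergence of characteristic functions into weak convergence.  *)

theory Submission
  imports Defs
begin

subsection \<open>Uniform convergence of characteristic functions of linear forms\<close>

text \<open>Two obstacles shape the estimates. First, the linear form in one column has random
  coefficients: they depend on the other columns and, along the sequence, on their lengths. A bound
  on bounded coefficient sets alone would call for a tail estimate. The error is therefore kept in
  the form \<open>\<epsilon> + \<epsilon> * (\<Sum>j\<in>J. \<bar>a j\<bar>)\<close>, valid for
  every \<open>a\<close>; since blocks are independent with first absolute moments at most 1, it
  integrates to at most \<epsilon> times 1 plus the sum of the \<open>\<bar>lam k\<bar>\<close>. The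
  threshold concerns only the column's own length, so the sides of the box may grow at unrelated
  rates. Second, the series for \<open>f\<close> converges in L2 of the product measure, while the
  summands of \<open>SL\<close> share coordinates and are dependent; the general second-moment bound
  loses a factor \<open>card L\<close>. The box is therefore fixed first, and the series is cut at a
  finite level, depending on the box, that beats this factor. The finite gap between that level and
  the fixed truncation is controlled by orthonormality, with a bound free of the box.\<close>

lemma norm_iexp_diff_le: "norm (iexp x - iexp y) \<le> \<bar>x - y\<bar>"
proof -
  have "iexp x - iexp y = iexp y * (iexp (x - y) - 1)"
    by (simp add: algebra_simps exp_add[symmetric])
  then have "norm (iexp x - iexp y) = norm (iexp (x - y) - 1)"
    by (simp only: norm_mult norm_exp_i_times mult_1)
  also have "\<dots> \<le> \<bar>x - y\<bar>"
    using iexp_approx1[of "x - y" 0] by simp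
  finally show ?thesis .
qed

lemma norm_integral_le_integral:
  fixes f :: "'a \<Rightarrow> 'b::{banach, second_countable_topology}"
  assumes "integrable M f" "integrable M h" "\<And>x. x \<in> space M \<Longrightarrow> norm (f x) \<le> h x"
  shows "norm (\<integral>x. f x \<partial>M) \<le> (\<integral>x. h x \<partial>M)"
  by (rule order_trans[OF integral_norm_bound])
     (auto intro!: integral_mono Bochner_Integration.integrable_norm assms)

lemma (in prob_space) integrable_iexp_real:
  "X \<in> borel_measurable M \<Longrightarrow> integrable M (\<lambda>x. iexp (X x))"
  by (rule integrable_iexp) auto

lemma (in prob_space) norm_integral_iexp_diff_le:
  assumes [measurable]: "X \<in> borel_measurable M" "Y \<in> borel_measurable M"
    and "integrable M (\<lambda>x. X x - Y x)"
  shows "norm ((\<integral>x. iexp (X x) \<partial>M) - (\<integral>x. iexp (Y x) \<partial>M)) \<le> (\<integral>x. \<bar>X x - Y x\<bar> \<partial>M)"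
proof -
  have "(\<integral>x. iexp (X x) \<partial>M) - (\<integral>x. iexp (Y x) \<partial>M) = (\<integral>x. iexp (X x) - iexp (Y x) \<partial>M)"
    by (rule Bochner_Integration.integral_diff[symmetric]) (auto intro!: integrable_iexp_real)
  also have "norm \<dots> \<le> (\<integral>x. \<bar>X x - Y x\<bar> \<partial>M)"
    by (intro norm_integral_le_integral Bochner_Integration.integrable_diff integrable_iexp_real)
       (auto intro!: norm_iexp_diff_le assms)
  finally show ?thesis .
qed

lemma (in prob_space) norm_integral_iexp_le_1:
  "X \<in> borel_measurable M \<Longrightarrow> norm (\<integral>x. iexp (X x) \<partial>M) \<le> 1"
  using integral_norm_bound[of M "\<lambda>x. iexp (X x)"] by (simp add: prob_space)

text \<open>This is nonnegativity of the variance of \<open>\<bar>X\<bar>\<close>. Every passage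
  from second moments to the L1 bounds on characteristic functions goes through it.\<close>

lemma (in prob_space) expectation_abs_le_sqrt:
  assumes [measurable]: "X \<in> borel_measurable M" and "integrable M (\<lambda>x. (X x)\<^sup>2)"
  shows "(\<integral>x. \<bar>X x\<bar> \<partial>M) \<le> sqrt (\<integral>x. (X x)\<^sup>2 \<partial>M)"
proof -
  have "integrable M X" by (rule square_integrable_imp_integrable[OF assms])
  then have "(\<integral>x. \<bar>X x\<bar> \<partial>M)\<^sup>2 \<le> (\<integral>x. \<bar>X x\<bar>\<^sup>2 \<partial>M)"
    using variance_positive[of "\<lambda>x. \<bar>X x\<bar>"] assms
    by (subst (asm) variance_eq) auto
  then show ?thesis by (simp add: real_le_rsqrt)
qed

text \<open>The joint characteristic function of the \<open>J\<close>-indexed law \<open>N\<close>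
  at the frequency vector \<open>a\<close>. Only the values of \<open>a\<close> on \<open>J\<close>
  enter.\<close>

definition lin_char :: "('j \<Rightarrow> real) measure \<Rightarrow> 'j set \<Rightarrow> ('j \<Rightarrow> real) \<Rightarrow> complex" where
  "lin_char N J a = (\<integral>y. iexp (\<Sum>j\<in>J. a j * y j) \<partial>N)"

lemma norm_lin_char_le_1:
  assumes "prob_space N" and [measurable_cong]: "sets N = sets (PiM J (\<lambda>_. borel))"
  shows "norm (lin_char N J a) \<le> 1"
  unfolding lin_char_def
  by (rule prob_space.norm_integral_iexp_le_1[OF assms(1)]) measurable

text \<open>Since \<open>iexp\<close> is 1-Lipschitz, the first absolute moments are the Lipschitz
  constants in the coordinates of \<open>a\<close>. The normalization by 1 gives all laws along the
  sequence the same constant, which is the equicontinuity used for uniform convergence.\<close>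

lemma norm_lin_char_diff_le:
  assumes "prob_space N" and [measurable_cong]: "sets N = sets (PiM J (\<lambda>_. borel))"
    and int: "\<And>j. j \<in> J \<Longrightarrow> integrable N (\<lambda>y. y j)"
    and le: "\<And>j. j \<in> J \<Longrightarrow> (\<integral>y. \<bar>y j\<bar> \<partial>N) \<le> 1"
  shows "norm (lin_char N J a - lin_char N J b) \<le> (\<Sum>j\<in>J. \<bar>a j - b j\<bar>)"
proof -
  interpret prob_space N by fact
  have eq: "(\<Sum>j\<in>J. a j * y j) - (\<Sum>j\<in>J. b j * y j) = (\<Sum>j\<in>J. (a j - b j) * y j)" for y
    by (simp add: sum_subtractf left_diff_distrib)
  have "norm (lin_char N J a - lin_char N J b) \<le> (\<integral>y. \<bar>\<Sum>j\<in>J. (a j - b j) * y j\<bar> \<partial>N)"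
    unfolding lin_char_def eq[symmetric]
    by (rule norm_integral_iexp_diff_le; (subst eq)?)
       (auto intro!: int Bochner_Integration.integrable_sum)
  also have "\<dots> \<le> (\<integral>y. (\<Sum>j\<in>J. \<bar>a j - b j\<bar> * \<bar>y j\<bar>) \<partial>N)"
    by (intro integral_mono integrable_abs Bochner_Integration.integrable_sum
          Bochner_Integration.integrable_mult_right int)
       (auto intro!: order_trans[OF sum_abs] sum_mono simp: abs_mult)
  also have "\<dots> = (\<Sum>j\<in>J. \<bar>a j - b j\<bar> * (\<integral>y. \<bar>y j\<bar> \<partial>N))"
    by (subst Bochner_Integration.integral_sum) (auto intro!: int)
  also have "\<dots> \<le> (\<Sum>j\<in>J. \<bar>a j - b j\<bar>)"
    using le by (intro sum_mono mult_left_le) auto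
  finally show ?thesis .
qed

text \<open>On the cube where all \<open>\<bar>a j\<bar> \<le> R\<close>, a finite net and the
  common Lipschitz constant upgrade pointwise to uniform convergence. Outside the cube the trivial
  bound 2 is absorbed by the linear term. One estimate thus covers all \<open>a\<close> and can be
  integrated over random coefficients.\<close>

lemma pointwise_lipschitz_imp_uniform:
  fixes \<Phi> :: "nat \<Rightarrow> ('j \<Rightarrow> real) \<Rightarrow> complex"
  assumes J: "finite J"
    and lip: "\<And>n a b. norm (\<Phi> n a - \<Phi> n b) \<le> (\<Sum>j\<in>J. \<bar>a j - b j\<bar>)"
    and lip': "\<And>a b. norm (\<Psi> a - \<Psi> b) \<le> (\<Sum>j\<in>J. \<bar>a j - b j\<bar>)"
    and le: "\<And>n a. norm (\<Phi> n a) \<le> 1" and le': "\<And>a. norm (\<Psi> a) \<le> 1"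
    and lim: "\<And>a. (\<lambda>n. \<Phi> n a) \<longlonglongrightarrow> \<Psi> a"
    and \<epsilon>: "0 < \<epsilon>"
  shows "\<exists>N. \<forall>n\<ge>N. \<forall>a. norm (\<Phi> n a - \<Psi> a) \<le> \<epsilon> + \<epsilon> * (\<Sum>j\<in>J. \<bar>a j\<bar>)"
proof -
  \<comment> \<open>\<open>R\<close> is chosen so that \<open>\<epsilon> * R = 2\<close>. The mesh
    \<open>h\<close> makes the two Lipschitz errors, each at most \<open>card J * h\<close>, add up
    to at most \<open>\<epsilon> / 2\<close>, leaving \<open>\<epsilon> / 2\<close> for the net
    point; the \<open>+ 1\<close> covers empty \<open>J\<close>.\<close>
  define R where "R = 2 / \<epsilon>"
  define h where "h = \<epsilon> / (4 * (real (card J) + 1))"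
  have h: "0 < h" "2 * (real (card J) * h) \<le> \<epsilon> / 2"
    using \<epsilon> by (auto simp: h_def field_simps)
  define K where "K = \<lceil>R / h\<rceil> + 1"
  define Net where "Net = PiE J (\<lambda>_. (\<lambda>z. h * real_of_int z) ` {-K..K})"
  have "finite Net" using J by (auto simp: Net_def intro!: finite_PiE)
  have "\<forall>b\<in>Net. \<forall>\<^sub>F n in sequentially. norm (\<Phi> n b - \<Psi> b) < \<epsilon> / 2"
    using tendstoD[OF lim, of "\<epsilon> / 2"] \<epsilon> by (simp add: dist_norm)
  then have "\<forall>\<^sub>F n in sequentially. \<forall>b\<in>Net. norm (\<Phi> n b - \<Psi> b) < \<epsilon> / 2"
    using \<open>finite Net\<close> by (simp add: eventually_ball_finite)
  then obtain N where N: "\<And>n b. n \<ge> N \<Longrightarrow> b \<in> Net \<Longrightarrow> norm (\<Phi> n b - \<Psi> b) < \<epsilon> / 2"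
    unfolding eventually_sequentially by blast
  have "norm (\<Phi> n a - \<Psi> a) \<le> \<epsilon> + \<epsilon> * (\<Sum>j\<in>J. \<bar>a j\<bar>)" if n: "n \<ge> N" for n a
  proof (cases "\<forall>j\<in>J. \<bar>a j\<bar> \<le> R")
    case True
    \<comment> \<open>Rounding each coordinate down to the grid moves it by at most
      \<open>h\<close>.\<close>
    define b where "b = (\<lambda>j\<in>J. h * real_of_int \<lfloor>a j / h\<rfloor>)"
    have ab: "\<bar>a j - b j\<bar> \<le> h" if "j \<in> J" for j
    proof -
      have "h * real_of_int \<lfloor>a j / h\<rfloor> \<le> h * (a j / h)" "h * (a j / h) \<le> h * (real_of_int \<lfloor>a j / h\<rfloor> + 1)"
        using h(1) by (intro mult_left_mono; linarith)+
      moreover have "h * (a j / h) = a j" using h by simp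
      ultimately show ?thesis using that by (simp add: b_def algebra_simps)
    qed
    have "b \<in> Net"
      unfolding Net_def b_def
    proof (intro restrict_PiE_iff[THEN iffD2] ballI imageI)
      fix j assume j: "j \<in> J"
      have "\<bar>a j / h\<bar> \<le> R / h" using True j h by (auto simp: abs_divide intro!: divide_right_mono)
      then have "a j / h \<le> R / h" "- (R / h) \<le> a j / h" by linarith+
      then show "\<lfloor>a j / h\<rfloor> \<in> {-K..K}"
        unfolding K_def by (auto simp: floor_le_iff le_floor_iff) linarith+
    qed
    have s: "(\<Sum>j\<in>J. \<bar>a j - b j\<bar>) \<le> real (card J) * h"
      using sum_mono[of J "\<lambda>j. \<bar>a j - b j\<bar>" "\<lambda>_. h"] ab by simp
    have "norm (\<Phi> n a - \<Psi> a) \<le> norm (\<Phi> n a - \<Phi> n b) + norm (\<Phi> n b - \<Psi> b) + norm (\<Psi> a - \<Psi> b)"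
      using norm_triangle_ineq4[of "\<Phi> n a - \<Phi> n b + (\<Phi> n b - \<Psi> b)" "\<Psi> a - \<Psi> b"]
        norm_triangle_ineq[of "\<Phi> n a - \<Phi> n b" "\<Phi> n b - \<Psi> b"] by simp
    also have "\<dots> \<le> \<epsilon>"
      using lip[of n a b] lip'[of a b] s N[OF n \<open>b \<in> Net\<close>] h(2) by linarith
    finally show ?thesis using \<epsilon> by (simp add: add_increasing2 sum_nonneg)
  next
    case False
    then obtain j where j: "j \<in> J" "\<bar>a j\<bar> > R" by auto
    have "norm (\<Phi> n a - \<Psi> a) \<le> 2"
      using norm_triangle_ineq4[of "\<Phi> n a" "\<Psi> a"] le[of n a] le'[of a] by linarith
    also have "\<dots> \<le> \<epsilon> * \<bar>a j\<bar>" using j(2) \<epsilon> by (simp add: R_def field_simps)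
    also have "\<dots> \<le> \<epsilon> * (\<Sum>j\<in>J. \<bar>a j\<bar>)"
      using member_le_sum[of j J "\<lambda>j. \<bar>a j\<bar>"] J j \<epsilon> by auto
    finally show ?thesis using \<epsilon> by simp
  qed
  then show ?thesis by blast
qed

subsection \<open>Replacing independent blocks one at a time\<close>

text \<open>Here \<open>y s\<close> is the vector of column \<open>s\<close>, and each monomial
  takes exactly one entry from each block in \<open>S\<close>. Keeping \<open>S\<close> and
  \<open>G\<close> as parameters lets the coefficients that remain after removing a block be
  polynomials of the same kind.\<close>

definition block_poly :: "('s \<Rightarrow> 'j) set \<Rightarrow> (('s \<Rightarrow> 'j) \<Rightarrow> real) \<Rightarrow> 's set \<Rightarrow> ('s \<Rightarrow> 'j \<Rightarrow> real) \<Rightarrow> real" where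
  "block_poly G lam S y = (\<Sum>k\<in>G. lam k * (\<Prod>s\<in>S. y s (k s)))"

lemma borel_measurable_block_poly:
  assumes sets: "\<And>s. s \<in> S \<Longrightarrow> sets (C s) = sets (PiM J (\<lambda>_. borel))"
    and J: "\<And>k s. k \<in> G \<Longrightarrow> s \<in> S \<Longrightarrow> k s \<in> J"
  shows "block_poly G lam S \<in> borel_measurable (PiM S C)"
proof -
  have "(\<lambda>y. y s (k s)) \<in> borel_measurable (PiM S C)" if "k \<in> G" "s \<in> S" for k s
  proof -
    have "(\<lambda>z. z (k s)) \<in> borel_measurable (C s)"
      using J[OF that] sets[OF that(2)] by (simp cong: measurable_cong_sets)
    then show ?thesis
      using measurable_compose[OF measurable_component_singleton[OF that(2)]] by blast
  qed
  then show ?thesis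
    unfolding block_poly_def[abs_def] by (auto intro!: borel_measurable_sum borel_measurable_times borel_measurable_prod)
qed

text \<open>Grouping the multi-indices by their entry at \<open>r\<close> collects the coefficient
  of \<open>y j\<close>: a polynomial over the fibre \<open>k r = j\<close> in the remaining
  blocks.\<close>

lemma block_poly_update:
  assumes "finite I" "r \<notin> I" "finite J" "finite G" "\<And>k. k \<in> G \<Longrightarrow> k r \<in> J"
  shows "block_poly G lam (insert r I) (x(r := y)) = (\<Sum>j\<in>J. block_poly {k\<in>G. k r = j} lam I x * y j)"
proof -
  have "(\<Sum>j\<in>J. block_poly {k\<in>G. k r = j} lam I x * y j)
      = (\<Sum>j\<in>J. \<Sum>k\<in>{k\<in>G. k r = j}. lam k * ((\<Prod>s\<in>I. x s (k s)) * y (k r)))"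
    by (simp add: block_poly_def sum_distrib_right mult.assoc)
  also have "\<dots> = (\<Sum>k\<in>G. lam k * ((\<Prod>s\<in>I. x s (k s)) * y (k r)))"
    using assms by (intro sum.group) auto
  also have "\<dots> = block_poly G lam (insert r I) (x(r := y))"
    unfolding block_poly_def
  proof (intro sum.cong refl)
    fix k
    have "(\<Prod>s\<in>I. (x(r := y)) s (k s)) = (\<Prod>s\<in>I. x s (k s))"
      using assms(2) by (intro prod.cong) auto
    then show "lam k * ((\<Prod>s\<in>I. x s (k s)) * y (k r)) = lam k * (\<Prod>s\<in>insert r I. (x(r := y)) s (k s))"
      using assms by (simp add: mult.commute)
  qed
  finally show ?thesis ..
qed

text \<open>On the product measure, the expectation of a product over distinct blocks is the product
  of first absolute moments, each at most 1. The integrand dominates the sum of absolute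
  coefficients left after one block is split off.\<close>

lemma block_poly_integral_bound:
  fixes C :: "'s \<Rightarrow> ('j \<Rightarrow> real) measure"
  assumes "finite I" "finite G" and C: "\<And>s. prob_space (C s)"
    and int: "\<And>k s. k \<in> G \<Longrightarrow> s \<in> I \<Longrightarrow> integrable (C s) (\<lambda>y. y (k s))"
    and le: "\<And>k s. k \<in> G \<Longrightarrow> s \<in> I \<Longrightarrow> (\<integral>y. \<bar>y (k s)\<bar> \<partial>C s) \<le> 1"
  shows "integrable (PiM I C) (\<lambda>x. \<Sum>k\<in>G. \<bar>lam k\<bar> * (\<Prod>s\<in>I. \<bar>x s (k s)\<bar>))"
    and "(\<integral>x. (\<Sum>k\<in>G. \<bar>lam k\<bar> * (\<Prod>s\<in>I. \<bar>x s (k s)\<bar>)) \<partial>PiM I C) \<le> (\<Sum>k\<in>G. \<bar>lam k\<bar>)"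
proof -
  interpret C: prob_space "C s" for s by (rule C)
  interpret product_prob_space C I ..
  have int_prod: "integrable (PiM I C) (\<lambda>x. \<Prod>s\<in>I. \<bar>x s (k s)\<bar>)" if "k \<in> G" for k
    using product_integrable_prod[of I "\<lambda>s y. \<bar>y (k s)\<bar>"] assms that by auto
  have "(\<integral>x. (\<Prod>s\<in>I. \<bar>x s (k s)\<bar>) \<partial>PiM I C) = (\<Prod>s\<in>I. (\<integral>y. \<bar>y (k s)\<bar> \<partial>C s))" if "k \<in> G" for k
    using product_integral_prod[of I "\<lambda>s y. \<bar>y (k s)\<bar>"] assms that by auto
  then have le1: "(\<integral>x. (\<Prod>s\<in>I. \<bar>x s (k s)\<bar>) \<partial>PiM I C) \<le> 1" if "k \<in> G" for k
    using that le by (auto intro!: prod_le_1)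
  show "integrable (PiM I C) (\<lambda>x. \<Sum>k\<in>G. \<bar>lam k\<bar> * (\<Prod>s\<in>I. \<bar>x s (k s)\<bar>))"
    using int_prod by auto
  have "(\<integral>x. (\<Sum>k\<in>G. \<bar>lam k\<bar> * (\<Prod>s\<in>I. \<bar>x s (k s)\<bar>)) \<partial>PiM I C)
      = (\<Sum>k\<in>G. \<bar>lam k\<bar> * (\<integral>x. (\<Prod>s\<in>I. \<bar>x s (k s)\<bar>) \<partial>PiM I C))"
    using int_prod by (subst Bochner_Integration.integral_sum) auto
  also have "\<dots> \<le> (\<Sum>k\<in>G. \<bar>lam k\<bar>)"
    using le1 by (intro sum_mono mult_left_le) auto
  finally show "(\<integral>x. (\<Sum>k\<in>G. \<bar>lam k\<bar> * (\<Prod>s\<in>I. \<bar>x s (k s)\<bar>)) \<partial>PiM I C) \<le> (\<Sum>k\<in>G. \<bar>lam k\<bar>)" .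
qed

text \<open>Given the other blocks, the polynomial is linear in block \<open>r\<close>, so only the characteristic
  functions of linear forms in that block enter.\<close>

lemma block_swap:
  fixes C :: "'s \<Rightarrow> ('j \<Rightarrow> real) measure"
  assumes I: "finite I" "r \<notin> I" and J: "finite J" and G: "finite G"
    and GJ: "\<And>k s. k \<in> G \<Longrightarrow> s \<in> insert r I \<Longrightarrow> k s \<in> J"
    and C: "\<And>s. prob_space (C s)" and setsC: "\<And>s. sets (C s) = sets (PiM J (\<lambda>_. borel))"
    and A: "prob_space A" and setsA: "sets A = sets (PiM J (\<lambda>_. borel))"
    and B: "prob_space B" and setsB: "sets B = sets (PiM J (\<lambda>_. borel))"
    and int: "\<And>s j. s \<in> I \<Longrightarrow> j \<in> J \<Longrightarrow> integrable (C s) (\<lambda>y. y j)"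
    and le: "\<And>s j. s \<in> I \<Longrightarrow> j \<in> J \<Longrightarrow> (\<integral>y. \<bar>y j\<bar> \<partial>C s) \<le> 1"
    and \<epsilon>: "0 \<le> \<epsilon>"
    and close: "\<And>a. norm (lin_char A J a - lin_char B J a) \<le> \<epsilon> + \<epsilon> * (\<Sum>j\<in>J. \<bar>a j\<bar>)"
  shows "norm ((\<integral>y. iexp (block_poly G lam (insert r I) y) \<partial>PiM (insert r I) (C(r := A)))
             - (\<integral>y. iexp (block_poly G lam (insert r I) y) \<partial>PiM (insert r I) (C(r := B))))
         \<le> \<epsilon> + \<epsilon> * (\<Sum>k\<in>G. \<bar>lam k\<bar>)"
proof -
  define a where "a = (\<lambda>x j. block_poly {k\<in>G. k r = j} lam I x)"
  interpret Q: prob_space "PiM I C" by (intro prob_space_PiM C)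
  have a_meas[measurable]: "(\<lambda>x. a x j) \<in> borel_measurable (PiM I C)" for j
    unfolding a_def by (rule borel_measurable_block_poly[where J=J]) (auto simp: GJ setsC)
  \<comment> \<open>Fubini with block \<open>r\<close> integrated first: for fixed \<open>x\<close>
    the polynomial is the linear form with coefficients \<open>a x\<close>, so the inner integral is
    \<open>lin_char D J (a x)\<close>. The outer measure does not involve \<open>D\<close>, which
    makes the two choices of block comparable.\<close>
  have main: "(\<integral>y. iexp (block_poly G lam (insert r I) y) \<partial>PiM (insert r I) (C(r := D)))
       = (\<integral>x. lin_char D J (a x) \<partial>PiM I C)"
    and intD: "integrable (PiM I C) (\<lambda>x. lin_char D J (a x))"
    if D: "prob_space D" and setsD: "sets D = sets (PiM J (\<lambda>_. borel))" for D
  proof -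
    have CD: "prob_space ((C(r := D)) s)" "sets ((C(r := D)) s) = sets (PiM J (\<lambda>_. borel))" for s
      using C D setsC setsD by auto
    interpret C: prob_space "(C(r := D)) s" for s by (rule CD)
    interpret product_prob_space "C(r := D)" I ..
    interpret PI: prob_space "PiM (insert r I) (C(r := D))" by (intro prob_space_PiM CD)
    interpret D: prob_space D by fact
    have eq: "PiM I (C(r := D)) = PiM I C" using I by (intro PiM_cong) auto
    have "integrable (PiM (insert r I) (C(r := D))) (\<lambda>y. iexp (block_poly G lam (insert r I) y))"
      by (intro PI.integrable_iexp_real borel_measurable_block_poly[where J=J] CD GJ)
    from product_integral_insert[OF I this]
    show "(\<integral>y. iexp (block_poly G lam (insert r I) y) \<partial>PiM (insert r I) (C(r := D)))
       = (\<integral>x. lin_char D J (a x) \<partial>PiM I C)"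
      using I J G GJ by (simp add: eq block_poly_update lin_char_def a_def)
    note [measurable_cong] = setsD
    have "(\<lambda>x. lin_char D J (a x)) \<in> borel_measurable (PiM I C)"
      unfolding lin_char_def by measurable
    then show "integrable (PiM I C) (\<lambda>x. lin_char D J (a x))"
      by (rule Q.integrable_const_bound[where B=1, rotated])
         (auto intro!: norm_lin_char_le_1 D setsD)
  qed
  let ?b = "\<lambda>x. \<Sum>k\<in>G. \<bar>lam k\<bar> * (\<Prod>s\<in>I. \<bar>x s (k s)\<bar>)"
  have b: "integrable (PiM I C) ?b" "(\<integral>x. ?b x \<partial>PiM I C) \<le> (\<Sum>k\<in>G. \<bar>lam k\<bar>)"
    using GJ by (intro block_poly_integral_bound I G C int le; simp)+
  \<comment> \<open>The fibres \<open>k r = j\<close> partition \<open>G\<close>, so the triangle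
    inequality inside each fibre loses nothing in the count of monomials.\<close>
  have a_le: "(\<Sum>j\<in>J. \<bar>a x j\<bar>) \<le> ?b x" for x
  proof -
    have "(\<Sum>j\<in>J. \<bar>a x j\<bar>) \<le> (\<Sum>j\<in>J. \<Sum>k\<in>{k\<in>G. k r = j}. \<bar>lam k\<bar> * (\<Prod>s\<in>I. \<bar>x s (k s)\<bar>))"
      unfolding a_def block_poly_def
      by (intro sum_mono order_trans[OF sum_abs]) (simp add: abs_mult abs_prod)
    also have "\<dots> = ?b x"
      using GJ J G by (intro sum.group) auto
    finally show ?thesis .
  qed
  have "norm ((\<integral>x. lin_char A J (a x) \<partial>PiM I C) - (\<integral>x. lin_char B J (a x) \<partial>PiM I C))
      = norm (\<integral>x. lin_char A J (a x) - lin_char B J (a x) \<partial>PiM I C)"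
    by (simp add: intD A B setsA setsB)
  also have "\<dots> \<le> (\<integral>x. \<epsilon> + \<epsilon> * ?b x \<partial>PiM I C)"
    by (intro norm_integral_le_integral Bochner_Integration.integrable_diff intD A B setsA setsB
         order_trans[OF close] add_left_mono mult_left_mono a_le \<epsilon>
         Bochner_Integration.integrable_add Bochner_Integration.integrable_mult_right b) auto
  also have "\<dots> = \<epsilon> + \<epsilon> * (\<integral>x. ?b x \<partial>PiM I C)"
    using b(1) by (subst Bochner_Integration.integral_add) (auto simp: Q.prob_space)
  also have "\<dots> \<le> \<epsilon> + \<epsilon> * (\<Sum>k\<in>G. \<bar>lam k\<bar>)"
    using b(2) \<epsilon> by (intro add_left_mono mult_left_mono)
  finally show ?thesis using A B setsA setsB by (simp only: main)
qed

text \<open>A Lindeberg-type telescoping sum over hybrid product measures: neighbouring hybrids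
  differ in one block, and each of the \<open>d\<close> swaps costs the same amount.\<close>

lemma block_replace_all:
  fixes A B :: "nat \<Rightarrow> ('j \<Rightarrow> real) measure"
  assumes J: "finite J" and G: "finite G" and GJ: "\<And>k s. k \<in> G \<Longrightarrow> s < d \<Longrightarrow> k s \<in> J"
    and A: "\<And>s. s < d \<Longrightarrow> prob_space (A s)"
    and setsA: "\<And>s. s < d \<Longrightarrow> sets (A s) = sets (PiM J (\<lambda>_. borel))"
    and intA: "\<And>s j. s < d \<Longrightarrow> j \<in> J \<Longrightarrow> integrable (A s) (\<lambda>y. y j)"
    and leA: "\<And>s j. s < d \<Longrightarrow> j \<in> J \<Longrightarrow> (\<integral>y. \<bar>y j\<bar> \<partial>A s) \<le> 1"
    and B: "\<And>s. s < d \<Longrightarrow> prob_space (B s)"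
    and setsB: "\<And>s. s < d \<Longrightarrow> sets (B s) = sets (PiM J (\<lambda>_. borel))"
    and intB: "\<And>s j. s < d \<Longrightarrow> j \<in> J \<Longrightarrow> integrable (B s) (\<lambda>y. y j)"
    and leB: "\<And>s j. s < d \<Longrightarrow> j \<in> J \<Longrightarrow> (\<integral>y. \<bar>y j\<bar> \<partial>B s) \<le> 1"
    and \<epsilon>: "0 \<le> \<epsilon>"
    and close: "\<And>s a. s < d \<Longrightarrow>
      norm (lin_char (A s) J a - lin_char (B s) J a) \<le> \<epsilon> + \<epsilon> * (\<Sum>j\<in>J. \<bar>a j\<bar>)"
  shows "norm ((\<integral>y. iexp (block_poly G lam {..<d} y) \<partial>PiM {..<d} A)
             - (\<integral>y. iexp (block_poly G lam {..<d} y) \<partial>PiM {..<d} B))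
         \<le> real d * (\<epsilon> + \<epsilon> * (\<Sum>k\<in>G. \<bar>lam k\<bar>))"
proof -
  \<comment> \<open>Hybrid \<open>r\<close> has the blocks below \<open>r\<close> already replaced,
    so \<open>H 0\<close> agrees with \<open>A\<close> and \<open>H d\<close> with \<open>B\<close>
    on \<open>{..<d}\<close>.\<close>
  define H where "H = (\<lambda>r s. if s < r then B s else A s)"
  define F where "F = (\<lambda>r. \<integral>y. iexp (block_poly G lam {..<d} y) \<partial>PiM {..<d} (H r))"
  have step: "norm (F r - F (Suc r)) \<le> \<epsilon> + \<epsilon> * (\<Sum>k\<in>G. \<bar>lam k\<bar>)" if r: "r < d" for r
  proof -
    \<comment> \<open>\<open>block_swap\<close> asks for a probability measure at every index,
      whereas \<open>A\<close> and \<open>B\<close> are controlled only below \<open>d\<close>;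
      \<open>A r\<close> is a harmless filler beyond.\<close>
    define C where "C = (\<lambda>s. if s < d then H r s else A r)"
    have ins: "{..<d} = insert r ({..<d} - {r})" using r by auto
    have "PiM {..<d} (H r) = PiM {..<d} (C(r := A r))"
      "PiM {..<d} (H (Suc r)) = PiM {..<d} (C(r := B r))"
      by (auto intro!: PiM_cong simp: C_def H_def)
    moreover have "norm ((\<integral>y. iexp (block_poly G lam (insert r ({..<d} - {r})) y)
          \<partial>PiM (insert r ({..<d} - {r})) (C(r := A r)))
        - (\<integral>y. iexp (block_poly G lam (insert r ({..<d} - {r})) y)
          \<partial>PiM (insert r ({..<d} - {r})) (C(r := B r))))
        \<le> \<epsilon> + \<epsilon> * (\<Sum>k\<in>G. \<bar>lam k\<bar>)"
      by (rule block_swap[where J=J])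
         (use r in \<open>auto simp: C_def H_def intro!: assms\<close>)
    ultimately show ?thesis unfolding F_def by (simp only: ins[symmetric])
  qed
  have "norm (F 0 - F r) \<le> real r * (\<epsilon> + \<epsilon> * (\<Sum>k\<in>G. \<bar>lam k\<bar>))" if "r \<le> d" for r
    using that
  proof (induction r)
    case (Suc r)
    have "norm (F 0 - F (Suc r)) \<le> norm (F 0 - F r) + norm (F r - F (Suc r))"
      using norm_triangle_ineq[of "F 0 - F r" "F r - F (Suc r)"] by simp
    then show ?case using Suc step[of r] by (simp add: algebra_simps)
  qed simp
  moreover have "PiM {..<d} (H 0) = PiM {..<d} A" "PiM {..<d} (H d) = PiM {..<d} B"
    by (auto intro!: PiM_cong simp: H_def)
  ultimately show ?thesis unfolding F_def by (metis order_refl)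
qed

subsection \<open>Normalized column sums\<close>

text \<open>The classical theorem normalizes by \<open>sqrt (real n * \<sigma>\<^sup>2)\<close>.
  Evaluating the characteristic functions at \<open>\<sigma>\<close> instead of 1 removes the
  variance from the normalization and puts it into the limit.\<close>

lemma (in prob_space) iexp_clt:
  fixes X :: "nat \<Rightarrow> 'a \<Rightarrow> real"
  assumes indep: "indep_vars (\<lambda>_. borel) X UNIV"
    and mean: "\<And>i. expectation (X i) = 0"
    and sq: "\<And>i. integrable M (\<lambda>x. (X i x)\<^sup>2)"
    and var: "\<And>i. expectation (\<lambda>x. (X i x)\<^sup>2) = v" and v: "0 < v"
    and distr: "\<And>i. distr M borel (X i) = \<mu>"
  shows "(\<lambda>n. \<integral>x. iexp ((\<Sum>i<n. X i x) / sqrt (real n)) \<partial>M) \<longlonglongrightarrow> exp (- v / 2)"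
proof -
  define \<sigma> where "\<sigma> = sqrt v"
  have \<sigma>: "\<sigma> > 0" "\<sigma>\<^sup>2 = v" using v by (auto simp: \<sigma>_def)
  have X[measurable]: "X i \<in> borel_measurable M" for i
    using indep unfolding indep_vars_def2 by simp
  have "weak_conv_m (\<lambda>n. distr M borel (\<lambda>x. (\<Sum>i<n. X i x) / sqrt (real n * \<sigma>\<^sup>2))) std_normal_distribution"
    by (rule central_limit_theorem_zero_mean[OF indep mean \<sigma>(1) sq _ distr]) (simp add: mean var \<sigma>)
  then have "(\<lambda>n. char (distr M borel (\<lambda>x. (\<Sum>i<n. X i x) / sqrt (real n * \<sigma>\<^sup>2))) \<sigma>)
      \<longlonglongrightarrow> char std_normal_distribution \<sigma>"
    by (intro levy_continuity1 real_distribution_distr real_dist_normal_dist) auto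
  moreover have "char (distr M borel (\<lambda>x. (\<Sum>i<n. X i x) / sqrt (real n * \<sigma>\<^sup>2))) \<sigma>
      = (\<integral>x. iexp ((\<Sum>i<n. X i x) / sqrt (real n)) \<partial>M)" for n
    unfolding char_def using \<sigma>(1) by (subst integral_distr) (auto simp: real_sqrt_mult)
  ultimately show ?thesis by (simp add: char_std_normal_distribution \<sigma>)
qed

lemma (in prob_space) iexp_linear_normal:
  fixes X :: "'j \<Rightarrow> 'a \<Rightarrow> real"
  assumes indep: "indep_vars (\<lambda>_. borel) X J"
    and normal: "\<And>j. j \<in> J \<Longrightarrow> distributed M lborel (X j) std_normal_density"
  shows "(\<integral>x. iexp (\<Sum>j\<in>J. a j * X j x) \<partial>M) = exp (- (\<Sum>j\<in>J. (a j)\<^sup>2) / 2)"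
proof -
  have X[measurable]: "X j \<in> borel_measurable M" if "j \<in> J" for j
    using indep that unfolding indep_vars_def2 by simp
  have "indep_vars (\<lambda>_. borel) (\<lambda>j x. a j * X j x) J"
    by (rule indep_vars_compose2[OF indep]) auto
  then have "char (distr M borel (\<lambda>x. \<Sum>j\<in>J. a j * X j x)) 1
      = (\<Prod>j\<in>J. char (distr M borel (\<lambda>x. a j * X j x)) 1)"
    by (rule char_distr_sum)
  also have "\<dots> = (\<Prod>j\<in>J. complex_of_real (exp (- (a j)\<^sup>2 / 2)))"
  proof (intro prod.cong refl)
    fix j assume j: "j \<in> J"
    have "std_normal_distribution = distr M borel (X j)"
      using normal[OF j] by (simp add: distributed_def cong: distr_cong)
    then have "char (distr M borel (\<lambda>x. a j * X j x)) 1 = char std_normal_distribution (a j)"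
      using X[OF j] by (simp add: char_def integral_distr)
    then show "char (distr M borel (\<lambda>x. a j * X j x)) 1 = complex_of_real (exp (- (a j)\<^sup>2 / 2))"
      by (simp add: char_std_normal_distribution)
  qed
  also have "\<dots> = exp (- (\<Sum>j\<in>J. (a j)\<^sup>2) / 2)"
  \<comment> \<open>For infinite \<open>J\<close> the conventions for sums and products make both
    sides 1.\<close>
  proof (cases "finite J")
    case True
    then show ?thesis
      by (simp add: exp_sum[symmetric] of_real_prod[symmetric] sum_negf sum_divide_distrib
               del: of_real_exp of_real_prod)
  qed simp
  finally show ?thesis
    by (simp add: char_def integral_distr)
qed

lemma integrable_mult_of_squares:
  fixes f h :: "'a \<Rightarrow> real"
  assumes [measurable]: "f \<in> borel_measurable M" "h \<in> borel_measurable M"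
    and "integrable M (\<lambda>x. (f x)\<^sup>2)" "integrable M (\<lambda>x. (h x)\<^sup>2)"
  shows "integrable M (\<lambda>x. f x * h x)"
proof (rule Bochner_Integration.integrable_bound)
  show "integrable M (\<lambda>x. (f x)\<^sup>2 + (h x)\<^sup>2)" using assms by simp
  show "AE x in M. norm (f x * h x) \<le> norm ((f x)\<^sup>2 + (h x)\<^sup>2)"
  proof (rule AE_I2)
    fix x
    show "norm (f x * h x) \<le> norm ((f x)\<^sup>2 + (h x)\<^sup>2)"
      using sum_squares_bound[of "\<bar>f x\<bar>" "\<bar>h x\<bar>"] abs_ge_zero[of "f x * h x"]
      unfolding real_norm_def abs_mult power2_abs by linarith
  qed
qed measurable

text \<open>Samples are numbered from 1, hence \<open>Suc i\<close>. For \<open>n = 0\<close> the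
  value is 0, which keeps the upper bounds on moments true for every \<open>n\<close>.\<close>

definition norm_sum :: "(nat \<Rightarrow> 's \<Rightarrow> 'b \<Rightarrow> 'a) \<Rightarrow> ('a \<Rightarrow> real) \<Rightarrow> 's \<Rightarrow> nat \<Rightarrow> 'b \<Rightarrow> real" where
  "norm_sum \<xi> h s n \<omega> = (\<Sum>i<n. h (\<xi> (Suc i) s \<omega>)) / sqrt (real n)"

section \<open>Independence, covariance and central limit theorem for sampled columns\<close>

locale iid_columns = prob_space P for P :: "'b measure" +
  fixes d :: nat and M :: "nat \<Rightarrow> 'a measure" and \<xi> :: "nat \<Rightarrow> nat \<Rightarrow> 'b \<Rightarrow> 'a"
  assumes indep: "indep_vars (\<lambda>(i, s). M s) (\<lambda>(i, s). \<xi> i s) ({1..} \<times> {..<d})"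
    and d_pos: "0 < d"
    and law: "\<And>i s. 1 \<le> i \<Longrightarrow> s < d \<Longrightarrow> distr P (M s) (\<xi> i s) = M s"
begin

lemma measurable_\<xi>: "1 \<le> i \<Longrightarrow> s < d \<Longrightarrow> \<xi> i s \<in> measurable P (M s)"
  using indep unfolding indep_vars_def2 by auto

lemma expectation_\<xi>:
  fixes h :: "'a \<Rightarrow> real"
  assumes "1 \<le> i" "s < d" "h \<in> borel_measurable (M s)"
  shows "expectation (\<lambda>\<omega>. h (\<xi> i s \<omega>)) = integral\<^sup>L (M s) h"
    and "integrable P (\<lambda>\<omega>. h (\<xi> i s \<omega>)) \<longleftrightarrow> integrable (M s) h"
  using integral_distr[OF measurable_\<xi>[OF assms(1,2)] assms(3)]
    integrable_distr_eq[OF measurable_\<xi>[OF assms(1,2)] assms(3)] law[OF assms(1,2)] by simp_all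

text \<open>The index sets of different columns are disjoint, so functions of whole columns are
  independent. Each \<open>Y s\<close> may look at the entire infinite column, so one statement
  serves both single samples and sums of any length.\<close>

lemma indep_columns:
  assumes "\<And>s. s < d \<Longrightarrow> Y s \<in> measurable (PiM ({1..} \<times> {s}) (\<lambda>(i, s). M s)) (N s)"
  shows "indep_vars N (\<lambda>s \<omega>. Y s (\<lambda>p\<in>{1..} \<times> {s}. \<xi> (fst p) (snd p) \<omega>)) {..<d}"
proof -
  have "indep_vars (\<lambda>s. PiM ({1..} \<times> {s}) (\<lambda>(i, s). M s))
      (\<lambda>s \<omega>. restrict (\<lambda>p. (case p of (i, s) \<Rightarrow> \<xi> i s) \<omega>) ({1..} \<times> {s})) {..<d}"
    by (rule indep_vars_restrict[OF indep]) (auto simp: disjoint_family_on_def)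
  from indep_vars_compose2[OF this, of Y N] assms show ?thesis
    by (simp add: case_prod_unfold)
qed

text \<open>The function \<open>H l\<close> may vary with the sample, so that two different
  functions evaluated at two samples are covered as well as one function along the column.\<close>

lemma indep_within_column:
  assumes "s < d" "\<And>l. H l \<in> borel_measurable (M s)"
  shows "indep_vars (\<lambda>_. borel) (\<lambda>l \<omega>. H l (\<xi> (Suc l) s \<omega>) :: real) UNIV"
proof -
  have ind: "indep_vars (\<lambda>l. PiM {(Suc l, s)} (\<lambda>(i, s). M s))
      (\<lambda>l \<omega>. restrict (\<lambda>p. (case p of (i, s) \<Rightarrow> \<xi> i s) \<omega>) {(Suc l, s)}) UNIV"
    by (rule indep_vars_restrict[OF indep]) (use assms in \<open>auto simp: disjoint_family_on_def\<close>)
  have m: "(\<lambda>z. H l (z (Suc l, s))) \<in> borel_measurable (PiM {(Suc l, s)} (\<lambda>(i, s). M s))" for l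
    using measurable_compose[OF _ assms(2)]
      measurable_component_singleton[of "(Suc l, s)" "{(Suc l, s)}" "\<lambda>(i, s). M s"] by simp
  show ?thesis
    using indep_vars_compose2[OF ind m] by simp
qed

lemma measurable_norm_sum:
  assumes "s < d" "h \<in> borel_measurable (M s)"
  shows "norm_sum \<xi> h s n \<in> borel_measurable P"
  unfolding norm_sum_def[abs_def]
  using assms measurable_compose[OF measurable_\<xi> assms(2)] by auto

text \<open>Off-diagonal terms vanish by independence and centering; the \<open>n\<close> equal
  diagonal terms cancel the factor \<open>1 / n\<close>. The covariance is therefore the same for
  every \<open>n \<ge> 1\<close>, the source of all uniformity in the box.\<close>

lemma norm_sum_covariance:
  assumes s: "s < d" and h[measurable]: "h \<in> borel_measurable (M s)" "h' \<in> borel_measurable (M s)"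
    and sq: "integrable (M s) (\<lambda>x. (h x)\<^sup>2)" "integrable (M s) (\<lambda>x. (h' x)\<^sup>2)"
    and zero: "integral\<^sup>L (M s) h = 0" "integral\<^sup>L (M s) h' = 0"
  shows "integrable P (\<lambda>\<omega>. norm_sum \<xi> h s n \<omega> * norm_sum \<xi> h' s n \<omega>)"
    and "1 \<le> n \<Longrightarrow> expectation (\<lambda>\<omega>. norm_sum \<xi> h s n \<omega> * norm_sum \<xi> h' s n \<omega>)
      = (\<integral>x. h x * h' x \<partial>M s)"
proof -
  have \<xi>_comp: "(\<lambda>\<omega>. f (\<xi> (Suc i) s \<omega>)) \<in> borel_measurable P" if "f \<in> borel_measurable (M s)"
    for i and f :: "'a \<Rightarrow> real"
    using measurable_compose[OF measurable_\<xi> that] s by simp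
  have Ms: "prob_space (M s)"
    using prob_space_distr[OF measurable_\<xi>[OF le_refl s]] law[OF le_refl s] by simp
  interpret Ms: prob_space "M s" by (rule Ms)
  have L1: "integrable (M s) h" "integrable (M s) h'"
    using h sq by (auto intro: Ms.square_integrable_imp_integrable)
  have hh': "integrable (M s) (\<lambda>x. h x * h' x)"
    using h sq by (rule integrable_mult_of_squares)
  have pair: "integrable P (\<lambda>\<omega>. h (\<xi> (Suc i) s \<omega>) * h' (\<xi> (Suc j) s \<omega>)) \<and>
      expectation (\<lambda>\<omega>. h (\<xi> (Suc i) s \<omega>) * h' (\<xi> (Suc j) s \<omega>))
        = (if i = j then \<integral>x. h x * h' x \<partial>M s else 0)" for i j
  proof (cases "i = j")
    case True
    then show ?thesis
      using expectation_\<xi>[of "Suc i" s "\<lambda>x. h x * h' x"] s hh' by simp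
  next
    case False
    \<comment> \<open>Placing \<open>h\<close> at sample \<open>i\<close> and \<open>h'\<close>
      elsewhere turns the product of two different functions into a product over the independent
      family indexed by \<open>{i, j}\<close>.\<close>
    define H where "H = (\<lambda>l. if l = i then h else h')"
    have H: "H l \<in> borel_measurable (M s)" "integrable (M s) (H l)" "integral\<^sup>L (M s) (H l) = 0" for l
      using L1 zero by (auto simp: H_def)
    have ind: "indep_vars (\<lambda>_. borel) (\<lambda>l \<omega>. H l (\<xi> (Suc l) s \<omega>)) {i, j}"
      by (rule indep_vars_subset[OF indep_within_column[OF s H(1)]]) auto
    have int: "integrable P (\<lambda>\<omega>. H l (\<xi> (Suc l) s \<omega>))" for l
      using expectation_\<xi>(2)[of "Suc l" s "H l"] s H by simp
    show ?thesis
      using indep_vars_lebesgue_integral[OF _ ind int] indep_vars_integrable[OF _ ind int] False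
        expectation_\<xi>(1)[of "Suc i" s h] zero s
      by (simp add: H_def)
  qed
  have eq: "norm_sum \<xi> h s n \<omega> * norm_sum \<xi> h' s n \<omega>
      = (\<Sum>i<n. \<Sum>j<n. h (\<xi> (Suc i) s \<omega>) * h' (\<xi> (Suc j) s \<omega>)) / real n" for \<omega>
    by (simp add: norm_sum_def sum_product)
  show "integrable P (\<lambda>\<omega>. norm_sum \<xi> h s n \<omega> * norm_sum \<xi> h' s n \<omega>)"
    unfolding eq using pair by auto
  show "expectation (\<lambda>\<omega>. norm_sum \<xi> h s n \<omega> * norm_sum \<xi> h' s n \<omega>) = (\<integral>x. h x * h' x \<partial>M s)"
    if "1 \<le> n"
    unfolding eq using pair that by (simp add: sum.delta)
qed

text \<open>The central limit theorem demands positive variance, but \<open>h\<close> will be a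
  linear combination whose coefficients may all vanish. With zero variance every normalized sum has
  second moment 0, and its characteristic function is 1 for each \<open>n \<ge> 1\<close>.\<close>

lemma iexp_norm_sum_tendsto:
  assumes s: "s < d" and h[measurable]: "h \<in> borel_measurable (M s)"
    and sq: "integrable (M s) (\<lambda>x. (h x)\<^sup>2)" and zero: "integral\<^sup>L (M s) h = 0"
  shows "(\<lambda>n. expectation (\<lambda>\<omega>. iexp (norm_sum \<xi> h s n \<omega>)))
    \<longlonglongrightarrow> exp (- (\<integral>x. (h x)\<^sup>2 \<partial>M s) / 2)"
proof (cases "(\<integral>x. (h x)\<^sup>2 \<partial>M s) = 0")
  case True
  have "expectation (\<lambda>\<omega>. iexp (norm_sum \<xi> h s n \<omega>)) = 1" if "1 \<le> n" for n
  proof -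
    note [measurable] = measurable_norm_sum[OF s h]
    note cov = norm_sum_covariance[OF s h h sq sq zero zero, of n, folded power2_eq_square]
    have "norm (expectation (\<lambda>\<omega>. iexp (norm_sum \<xi> h s n \<omega>)) - expectation (\<lambda>\<omega>. iexp 0))
        \<le> expectation (\<lambda>\<omega>. \<bar>norm_sum \<xi> h s n \<omega> - 0\<bar>)"
      by (rule norm_integral_iexp_diff_le)
         (use cov(1) in \<open>auto intro: square_integrable_imp_integrable\<close>)
    also have "\<dots> \<le> sqrt (expectation (\<lambda>\<omega>. (norm_sum \<xi> h s n \<omega>)\<^sup>2))"
      using expectation_abs_le_sqrt[OF _ cov(1)] by simp
    also have "\<dots> = 0" using cov(2)[OF that] True by simp
    finally show ?thesis by (simp add: prob_space)
  qed
  then have "\<forall>\<^sub>F n in sequentially. expectation (\<lambda>\<omega>. iexp (norm_sum \<xi> h s n \<omega>)) = 1"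
    unfolding eventually_sequentially by blast
  then show ?thesis using True by (simp add: tendsto_eventually)
next
  case False
  then have pos: "0 < (\<integral>x. (h x)\<^sup>2 \<partial>M s)"
    by (simp add: less_le)
  show ?thesis
    unfolding norm_sum_def
  proof (rule iexp_clt[OF indep_within_column[OF s h] _ _ _ pos])
    show "distr P borel (\<lambda>\<omega>. h (\<xi> (Suc i) s \<omega>)) = distr (M s) borel h" for i
      using distr_distr[OF h measurable_\<xi>[of "Suc i" s]] s law[of "Suc i" s] by (simp add: comp_def)
  qed (use expectation_\<xi>[of "Suc _" s h] expectation_\<xi>[of "Suc _" s "\<lambda>x. (h x)\<^sup>2"] s sq zero in auto)
qed

end

text \<open>Independence means that the joint law of the columns is the product of their laws. This
  moves the expectation to a product space, where blocks can be exchanged; \<open>0 < d\<close>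
  makes the family nonempty, as this characterization requires.\<close>

lemma (in prob_space) integral_iexp_block_poly:
  fixes V :: "nat \<Rightarrow> 'a \<Rightarrow> 'j \<Rightarrow> real"
  assumes ind: "indep_vars (\<lambda>_. PiM J (\<lambda>_. borel)) V {..<d}" and d: "0 < d"
    and GJ: "\<And>k s. k \<in> G \<Longrightarrow> s < d \<Longrightarrow> k s \<in> J"
  shows "(\<integral>x. iexp (\<Sum>k\<in>G. lam k * (\<Prod>s<d. V s x (k s))) \<partial>M)
    = (\<integral>y. iexp (block_poly G lam {..<d} y) \<partial>PiM {..<d} (\<lambda>s. distr M (PiM J (\<lambda>_. borel)) (V s)))"
proof -
  have V: "V s \<in> measurable M (PiM J (\<lambda>_. borel))" if "s \<in> {..<d}" for s
    using ind that unfolding indep_vars_def2 by simp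
  have "distr M (PiM {..<d} (\<lambda>_. PiM J (\<lambda>_. borel))) (\<lambda>x. \<lambda>s\<in>{..<d}. V s x)
      = PiM {..<d} (\<lambda>s. distr M (PiM J (\<lambda>_. borel)) (V s))"
    using d by (intro indep_vars_iff_distr_eq_PiM'[THEN iffD1] ind V) auto
  moreover have "(\<lambda>x. \<lambda>s\<in>{..<d}. V s x) \<in> measurable M (PiM {..<d} (\<lambda>_. PiM J (\<lambda>_. borel)))"
    by (intro measurable_restrict V)
  moreover have "(\<lambda>y. iexp (block_poly G lam {..<d} y))
      \<in> borel_measurable (PiM {..<d} (\<lambda>_. PiM J (\<lambda>_. borel)))"
    using borel_measurable_block_poly[of "{..<d}" "\<lambda>_. PiM J (\<lambda>_. borel)" J G lam] GJ
    by simp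
  ultimately show ?thesis
    by (simp add: integral_distr block_poly_def flip: \<open>distr M _ _ = _\<close>)
qed

section \<open>Law of the sample points and second moments of \<open>SL\<close>\<close>

context iid_columns
begin

text \<open>The coordinates of one sample point come from distinct columns, hence are independent
  with the laws \<open>M s\<close>. L2 statements on the product space thus transfer to every single
  summand of \<open>SL\<close>.\<close>

lemma distr_point:
  assumes "\<And>s. s < d \<Longrightarrow> 1 \<le> \<kappa> s"
  shows "(\<lambda>\<omega>. \<lambda>s\<in>{..<d}. \<xi> (\<kappa> s) s \<omega>) \<in> measurable P (PiM {..<d} M)"
    and "distr P (PiM {..<d} M) (\<lambda>\<omega>. \<lambda>s\<in>{..<d}. \<xi> (\<kappa> s) s \<omega>) = PiM {..<d} M"
proof -
  have m: "\<xi> (\<kappa> s) s \<in> measurable P (M s)" if "s \<in> {..<d}" for s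
    using that assms by (intro measurable_\<xi>) auto
  then show "(\<lambda>\<omega>. \<lambda>s\<in>{..<d}. \<xi> (\<kappa> s) s \<omega>) \<in> measurable P (PiM {..<d} M)"
    by (intro measurable_restrict)
  have "indep_vars M (\<lambda>s \<omega>. (\<lambda>z. z (\<kappa> s, s)) (\<lambda>p\<in>{1..} \<times> {s}. \<xi> (fst p) (snd p) \<omega>)) {..<d}"
  proof (rule indep_columns)
    fix s assume "s < d"
    then show "(\<lambda>z. z (\<kappa> s, s)) \<in> measurable (PiM ({1..} \<times> {s}) (\<lambda>(i, s). M s)) (M s)"
      using measurable_component_singleton[of "(\<kappa> s, s)" "{1..} \<times> {s}" "\<lambda>(i, s). M s"] assms
      by simp
  qed
  then have "indep_vars M (\<lambda>s \<omega>. \<xi> (\<kappa> s) s \<omega>) {..<d}"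
    by (subst indep_vars_cong[OF refl _ refl]) (use assms in auto)
  then have "distr P (PiM {..<d} M) (\<lambda>\<omega>. \<lambda>s\<in>{..<d}. \<xi> (\<kappa> s) s \<omega>)
      = PiM {..<d} (\<lambda>s. distr P (M s) (\<xi> (\<kappa> s) s))"
    using d_pos by (subst (asm) indep_vars_iff_distr_eq_PiM') (auto intro!: m)
  also have "\<dots> = PiM {..<d} M"
    using assms law by (intro PiM_cong) auto
  finally show "distr P (PiM {..<d} M) (\<lambda>\<omega>. \<lambda>s\<in>{..<d}. \<xi> (\<kappa> s) s \<omega>) = PiM {..<d} M" .
qed

lemma SL_measurable:
  assumes L: "\<And>\<kappa> s. \<kappa> \<in> L \<Longrightarrow> s < d \<Longrightarrow> 1 \<le> \<kappa> s" and h: "h \<in> borel_measurable (PiM {..<d} M)"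
  shows "SL d \<xi> h L \<in> borel_measurable P"
  unfolding SL_def[abs_def]
  using measurable_compose[OF distr_point(1) h] L by auto

text \<open>A crude bound: it is only applied to remainders with second moment small compared with \<open>1 / card L\<close>.\<close>

lemma SL_second_moment_le:
  assumes L: "finite L" "\<And>\<kappa> s. \<kappa> \<in> L \<Longrightarrow> s < d \<Longrightarrow> 1 \<le> \<kappa> s"
    and h: "h \<in> borel_measurable (PiM {..<d} M)"
    and sq: "integrable (PiM {..<d} M) (\<lambda>x. (h x)\<^sup>2)"
  shows "integrable P (\<lambda>\<omega>. (SL d \<xi> h L \<omega>)\<^sup>2)"
    and "expectation (\<lambda>\<omega>. (SL d \<xi> h L \<omega>)\<^sup>2) \<le> real (card L) * (\<integral>x. (h x)\<^sup>2 \<partial>PiM {..<d} M)"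
proof -
  let ?x = "\<lambda>\<kappa> \<omega>. \<lambda>s\<in>{..<d}. \<xi> (\<kappa> s) s \<omega>"
  have point: "integrable P (\<lambda>\<omega>. (h (?x \<kappa> \<omega>))\<^sup>2)"
    "expectation (\<lambda>\<omega>. (h (?x \<kappa> \<omega>))\<^sup>2) = (\<integral>x. (h x)\<^sup>2 \<partial>PiM {..<d} M)" if "\<kappa> \<in> L" for \<kappa>
    using integrable_distr_eq[OF distr_point(1)[OF L(2)[OF that]], where f="\<lambda>x. (h x)\<^sup>2"]
      integral_distr[OF distr_point(1)[OF L(2)[OF that]], where f="\<lambda>x. (h x)\<^sup>2"]
      distr_point(2)[OF L(2)[OF that]] h sq by auto
  \<comment> \<open>Cauchy-Schwarz: the factor \<open>card L\<close> it produces cancels against the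
    normalization. No independence is used, because points of \<open>L\<close> with a common
    coordinate give dependent summands.\<close>
  have le: "(SL d \<xi> h L \<omega>)\<^sup>2 \<le> (\<Sum>\<kappa>\<in>L. (h (?x \<kappa> \<omega>))\<^sup>2)" for \<omega>
  proof (cases "L = {}")
    case False
    then have "0 < real (card L)" using L(1) by (simp add: card_gt_0_iff)
    then show ?thesis
      using sum_squared_le_sum_of_squares[of "\<lambda>\<kappa>. h (?x \<kappa> \<omega>)" L]
      by (simp add: SL_def power_divide divide_le_eq)
  qed (simp add: SL_def)
  have int: "integrable P (\<lambda>\<omega>. \<Sum>\<kappa>\<in>L. (h (?x \<kappa> \<omega>))\<^sup>2)"
    using point by auto
  have "SL d \<xi> h L \<in> borel_measurable P"
    by (rule SL_measurable[OF _ h]) (rule L(2))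
  then show SL_int: "integrable P (\<lambda>\<omega>. (SL d \<xi> h L \<omega>)\<^sup>2)"
    using le by (intro Bochner_Integration.integrable_bound[OF int]) (auto simp: sum_nonneg)
  have "expectation (\<lambda>\<omega>. (SL d \<xi> h L \<omega>)\<^sup>2) \<le> expectation (\<lambda>\<omega>. \<Sum>\<kappa>\<in>L. (h (?x \<kappa> \<omega>))\<^sup>2)"
    by (intro integral_mono SL_int int le)
  also have "\<dots> = real (card L) * (\<integral>x. (h x)\<^sup>2 \<partial>PiM {..<d} M)"
    using point by (subst Bochner_Integration.integral_sum) auto
  finally show "expectation (\<lambda>\<omega>. (SL d \<xi> h L \<omega>)\<^sup>2) \<le> real (card L) * (\<integral>x. (h x)\<^sup>2 \<partial>PiM {..<d} M)" .
qed

lemma indep_norm_sum_columns: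
  assumes "\<And>s j. s < d \<Longrightarrow> j \<in> J \<Longrightarrow> g s j \<in> borel_measurable (M s)"
  shows "indep_vars (\<lambda>_. PiM J (\<lambda>_. borel)) (\<lambda>s \<omega>. \<lambda>j\<in>J. norm_sum \<xi> (g s j) s (n s) \<omega>) {..<d}"
proof -
  let ?Y = "\<lambda>s z. \<lambda>j\<in>J. (\<Sum>i<n s. g s j (z (Suc i, s))) / sqrt (real (n s))"
  have "indep_vars (\<lambda>_. PiM J (\<lambda>_. borel))
      (\<lambda>s \<omega>. ?Y s (\<lambda>p\<in>{1..} \<times> {s}. \<xi> (fst p) (snd p) \<omega>)) {..<d}"
  proof (rule indep_columns, rule measurable_restrict)
    fix s j assume "s < d" "j \<in> J"
    have "(\<lambda>z. g s j (z (Suc i, s))) \<in> borel_measurable (PiM ({1..} \<times> {s}) (\<lambda>(i, s). M s))" for i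
      using measurable_compose[OF _ assms[OF \<open>s < d\<close> \<open>j \<in> J\<close>]]
        measurable_component_singleton[of "(Suc i, s)" "{1..} \<times> {s}" "\<lambda>(i, s). M s"] by simp
    then show "(\<lambda>z. (\<Sum>i<n s. g s j (z (Suc i, s))) / sqrt (real (n s)))
        \<in> borel_measurable (PiM ({1..} \<times> {s}) (\<lambda>(i, s). M s))"
      by auto
  qed
  then show ?thesis by (simp add: norm_sum_def)
qed

end

text \<open>Only the convention outside \<open>{..<d}\<close> differs: the value is 0 in
  \<open>box_idx\<close> and \<open>undefined\<close> in \<open>PiE\<close>.\<close>

lemma bij_betw_box_idx: "bij_betw (\<lambda>\<kappa>. restrict \<kappa> {..<d}) (box_idx d n) (PiE {..<d} (\<lambda>s. {1..n s}))"
  by (rule bij_betw_byWitness[where f'="\<lambda>\<kappa> s. if s < d then \<kappa> s else 0"])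
     (auto simp: box_idx_def PiE_def extensional_def restrict_def fun_eq_iff)

lemma finite_box_idx: "finite (box_idx d n)"
  using bij_betw_finite[OF bij_betw_box_idx] by (simp add: finite_PiE)

lemma card_box_idx: "card (box_idx d n) = (\<Prod>s<d. n s)"
  using bij_betw_same_card[OF bij_betw_box_idx[of d n]] by (simp add: card_PiE)

text \<open>Here the box shape enters: by distributivity the sum over the box of a product is a
  product of column sums, and the square root of the cardinality factors in the same way.\<close>

lemma SL_tens_box:
  "SL d \<xi> (tens d g k) (box_idx d n) \<omega> = (\<Prod>s<d. norm_sum \<xi> (g s (k s)) s (n s) \<omega>)"
proof -
  have "(\<Prod>s<d. \<Sum>i<n s. g s (k s) (\<xi> (Suc i) s \<omega>)) = (\<Prod>s<d. \<Sum>i\<in>{1..n s}. g s (k s) (\<xi> i s \<omega>))"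
    by (simp add: sum.atLeast1_atMost_eq)
  also have "\<dots> = (\<Sum>\<kappa>\<in>PiE {..<d} (\<lambda>s. {1..n s}). \<Prod>s<d. g s (k s) (\<xi> (\<kappa> s) s \<omega>))"
    by (rule prod_sum_PiE) auto
  also have "\<dots> = (\<Sum>\<kappa>\<in>box_idx d n. tens d g k (\<lambda>s\<in>{..<d}. \<xi> (\<kappa> s) s \<omega>))"
    by (subst sum.reindex_bij_betw[OF bij_betw_box_idx, symmetric]) (simp add: tens_def)
  moreover have "sqrt (real (card (box_idx d n))) = (\<Prod>s<d. sqrt (real (n s)))"
    unfolding card_box_idx by (induction d) (auto simp: real_sqrt_mult)
  ultimately show ?thesis
    by (simp add: SL_def norm_sum_def prod_dividef)
qed

subsection \<open>Orthonormality of the tensor sums\<close>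

locale tensor_columns = iid_columns P d M \<xi>
  for P :: "'b measure" and d :: nat and M :: "nat \<Rightarrow> 'a measure" and \<xi> +
  fixes Mb :: enat and g :: "nat \<Rightarrow> nat \<Rightarrow> 'a \<Rightarrow> real"
  assumes g_meas: "\<And>s j. s < d \<Longrightarrow> 1 \<le> j \<Longrightarrow> enat j \<le> Mb \<Longrightarrow> g s j \<in> borel_measurable (M s)"
    and g_sq: "\<And>s j. s < d \<Longrightarrow> 1 \<le> j \<Longrightarrow> enat j \<le> Mb \<Longrightarrow> integrable (M s) (\<lambda>x. (g s j x)\<^sup>2)"
    and g_centered: "\<And>s j. s < d \<Longrightarrow> 1 \<le> j \<Longrightarrow> enat j \<le> Mb \<Longrightarrow> integral\<^sup>L (M s) (g s j) = 0"
    and g_orthonormal: "\<And>s j j'. s < d \<Longrightarrow> 1 \<le> j \<Longrightarrow> enat j \<le> Mb \<Longrightarrow> 1 \<le> j' \<Longrightarrow> enat j' \<le> Mb \<Longrightarrow>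
         (\<integral>x. g s j x * g s j' x \<partial>M s) = (if j = j' then 1 else 0)"
begin

text \<open>By \<open>SL_tens_box\<close> this is \<open>SL\<close> of \<open>tens d g k\<close>
  over the box with sides \<open>n\<close>.\<close>

definition tens_sum :: "(nat \<Rightarrow> nat) \<Rightarrow> (nat \<Rightarrow> nat) \<Rightarrow> 'b \<Rightarrow> real" where
  "tens_sum n k \<omega> = (\<Prod>s<d. norm_sum \<xi> (g s (k s)) s (n s) \<omega>)"

lemma idxD: "k \<in> idx d Mb \<Longrightarrow> s < d \<Longrightarrow> 1 \<le> k s" "k \<in> idx d Mb \<Longrightarrow> s < d \<Longrightarrow> enat (k s) \<le> Mb"
  by (auto simp: idx_def)

lemma idx_ext: "k \<in> idx d Mb \<Longrightarrow> k' \<in> idx d Mb \<Longrightarrow> (\<And>s. s < d \<Longrightarrow> k s = k' s) \<Longrightarrow> k = k'"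
  by (auto simp: idx_def fun_eq_iff) (metis not_le)

text \<open>Independence of the columns factors the expectation into column covariances. Each is 1
  or 0 by orthonormality of the \<open>g s j\<close>, and one differing entry already annihilates
  the product.\<close>

lemma tens_sum_orthonormal:
  assumes k: "k \<in> idx d Mb" and k': "k' \<in> idx d Mb"
  shows "integrable P (\<lambda>\<omega>. tens_sum n k \<omega> * tens_sum n k' \<omega>)"
    and "(\<And>s. s < d \<Longrightarrow> 1 \<le> n s) \<Longrightarrow>
      expectation (\<lambda>\<omega>. tens_sum n k \<omega> * tens_sum n k' \<omega>) = (if k = k' then 1 else 0)"
proof -
  \<comment> \<open>\<open>J\<close> collects the finitely many entries of both multi-indices, so
    that one vector per column carries both factors to be multiplied.\<close>
  define J where "J = k ` {..<d} \<union> k' ` {..<d}"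
  let ?X = "\<lambda>s \<omega>. norm_sum \<xi> (g s (k s)) s (n s) \<omega> * norm_sum \<xi> (g s (k' s)) s (n s) \<omega>"
  have eq: "tens_sum n k \<omega> * tens_sum n k' \<omega> = (\<Prod>s<d. ?X s \<omega>)" for \<omega>
    by (simp add: tens_sum_def prod.distrib)
  have "indep_vars (\<lambda>_. PiM J (\<lambda>_. borel)) (\<lambda>s \<omega>. \<lambda>j\<in>J. norm_sum \<xi> (g s j) s (n s) \<omega>) {..<d}"
    using k k' by (intro indep_norm_sum_columns g_meas) (auto simp: J_def idx_def)
  then have "indep_vars (\<lambda>_. borel) (\<lambda>s \<omega>. (\<lambda>z. z (k s) * z (k' s))
      (\<lambda>j\<in>J. norm_sum \<xi> (g s j) s (n s) \<omega>)) {..<d}"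
  proof (rule indep_vars_compose2)
    fix s assume "s \<in> {..<d}"
    then show "(\<lambda>z. z (k s) * z (k' s) :: real) \<in> borel_measurable (PiM J (\<lambda>_. borel))"
      by (intro borel_measurable_times measurable_component_singleton) (auto simp: J_def)
  qed
  then have ind: "indep_vars (\<lambda>_. borel) ?X {..<d}"
    by (subst indep_vars_cong[OF refl _ refl]) (auto simp: J_def)
  have int: "integrable P (?X s)" if "s \<in> {..<d}" for s
    using that by (intro norm_sum_covariance g_meas g_sq g_centered idxD[OF k] idxD[OF k']) auto
  show "integrable P (\<lambda>\<omega>. tens_sum n k \<omega> * tens_sum n k' \<omega>)"
    unfolding eq by (rule indep_vars_integrable[OF _ ind int]) auto
  assume n: "\<And>s. s < d \<Longrightarrow> 1 \<le> n s"
  have "expectation (\<lambda>\<omega>. tens_sum n k \<omega> * tens_sum n k' \<omega>) = (\<Prod>s<d. expectation (?X s))"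
    unfolding eq by (rule indep_vars_lebesgue_integral[OF _ ind int]) auto
  also have "\<dots> = (\<Prod>s<d. if k s = k' s then 1 else 0)"
  proof (intro prod.cong refl)
    fix s assume "s \<in> {..<d}"
    then have s: "s < d" by simp
    have "expectation (?X s) = (\<integral>x. g s (k s) x * g s (k' s) x \<partial>M s)"
      using s by (intro norm_sum_covariance g_meas g_sq g_centered idxD[OF k] idxD[OF k'] n)
    also have "\<dots> = (if k s = k' s then 1 else 0)"
      using s by (intro g_orthonormal idxD[OF k] idxD[OF k'])
    finally show "expectation (?X s) = (if k s = k' s then 1 else 0)" .
  qed
  also have "\<dots> = (if k = k' then 1 else 0)"
    using idx_ext[OF k k'] by (auto simp: prod_zero_iff)
  finally show "expectation (\<lambda>\<omega>. tens_sum n k \<omega> * tens_sum n k' \<omega>) = (if k = k' then 1 else 0)" .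
qed

text \<open>The value depends on the coefficients only: a small coefficient tail gives a small L2
  error simultaneously for all boxes with positive sides.\<close>

lemma tens_sum_Parseval:
  assumes D: "finite D" "D \<subseteq> idx d Mb"
  shows "integrable P (\<lambda>\<omega>. (\<Sum>k\<in>D. lam k * tens_sum n k \<omega>)\<^sup>2)"
    and "(\<And>s. s < d \<Longrightarrow> 1 \<le> n s) \<Longrightarrow>
      expectation (\<lambda>\<omega>. (\<Sum>k\<in>D. lam k * tens_sum n k \<omega>)\<^sup>2) = (\<Sum>k\<in>D. (lam k)\<^sup>2)"
proof -
  have eq: "(\<Sum>k\<in>D. lam k * tens_sum n k \<omega>)\<^sup>2
      = (\<Sum>k\<in>D. \<Sum>k'\<in>D. lam k * lam k' * (tens_sum n k \<omega> * tens_sum n k' \<omega>))" for \<omega>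
    by (simp add: power2_eq_square sum_product mult_ac)
  have int: "integrable P (\<lambda>\<omega>. lam k * lam k' * (tens_sum n k \<omega> * tens_sum n k' \<omega>))"
    if "k \<in> D" "k' \<in> D" for k k'
    using that D by (intro Bochner_Integration.integrable_mult_right tens_sum_orthonormal) auto
  show "integrable P (\<lambda>\<omega>. (\<Sum>k\<in>D. lam k * tens_sum n k \<omega>)\<^sup>2)"
    unfolding eq by (intro Bochner_Integration.integrable_sum int)
  assume n: "\<And>s. s < d \<Longrightarrow> 1 \<le> n s"
  have "expectation (\<lambda>\<omega>. (\<Sum>k\<in>D. lam k * tens_sum n k \<omega>)\<^sup>2)
      = (\<Sum>k\<in>D. expectation (\<lambda>\<omega>. \<Sum>k'\<in>D. lam k * lam k' * (tens_sum n k \<omega> * tens_sum n k' \<omega>)))"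
    unfolding eq by (intro Bochner_Integration.integral_sum Bochner_Integration.integrable_sum int)
  also have "\<dots> = (\<Sum>k\<in>D. \<Sum>k'\<in>D.
      expectation (\<lambda>\<omega>. lam k * lam k' * (tens_sum n k \<omega> * tens_sum n k' \<omega>)))"
    by (intro sum.cong refl Bochner_Integration.integral_sum int)
  also have "\<dots> = (\<Sum>k\<in>D. \<Sum>k'\<in>D. if k = k' then lam k * lam k' else 0)"
    using D tens_sum_orthonormal(2)[OF _ _ n] by (intro sum.cong refl) (auto simp: subset_iff)
  also have "\<dots> = (\<Sum>k\<in>D. (lam k)\<^sup>2)"
    using D(1) by (simp add: sum.delta power2_eq_square)
  finally show "expectation (\<lambda>\<omega>. (\<Sum>k\<in>D. lam k * tens_sum n k \<omega>)\<^sup>2) = (\<Sum>k\<in>D. (lam k)\<^sup>2)" .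
qed

lemma tens_sum_measurable:
  assumes "k \<in> idx d Mb"
  shows "tens_sum n k \<in> borel_measurable P"
  unfolding tens_sum_def[abs_def]
  using assms idxD by (auto intro!: borel_measurable_prod measurable_norm_sum g_meas)

end

section \<open>Independent Gaussian columns\<close>

locale gaussian_columns = prob_space Q for Q :: "'c measure" +
  fixes d :: nat and \<beta> :: "nat \<Rightarrow> nat \<Rightarrow> 'c \<Rightarrow> real"
  assumes \<beta>_indep: "indep_vars (\<lambda>_. borel) (\<lambda>(s, j). \<beta> s j) ({..<d} \<times> {1..})"
    and \<beta>_normal: "\<And>s j. s < d \<Longrightarrow> 1 \<le> j \<Longrightarrow> distributed Q lborel (\<beta> s j) std_normal_density"
begin

lemma \<beta>_second_moment:
  assumes "s < d" "1 \<le> j"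
  shows "integrable Q (\<lambda>\<omega>. (\<beta> s j \<omega>)\<^sup>2)" "expectation (\<lambda>\<omega>. (\<beta> s j \<omega>)\<^sup>2) = 1"
proof -
  show "integrable Q (\<lambda>\<omega>. (\<beta> s j \<omega>)\<^sup>2)"
    using distributed_integrable[OF \<beta>_normal[OF assms], of "\<lambda>x. x\<^sup>2"] integrable_std_normal_moment[of 2]
    by simp
  show "expectation (\<lambda>\<omega>. (\<beta> s j \<omega>)\<^sup>2) = 1"
    using distributed_integral[OF \<beta>_normal[OF assms], of "\<lambda>x. x\<^sup>2"] integral_std_normal_moment_even[of 1]
    by simp
qed

lemma \<beta>_measurable: "s < d \<Longrightarrow> 1 \<le> j \<Longrightarrow> \<beta> s j \<in> borel_measurable Q"
  using \<beta>_indep unfolding indep_vars_def2 by auto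

lemma indep_\<beta>_columns:
  assumes "J \<subseteq> {1..}"
  shows "indep_vars (\<lambda>_. PiM J (\<lambda>_. borel)) (\<lambda>s \<omega>. \<lambda>j\<in>J. \<beta> s j \<omega>) {..<d}"
proof -
  have "indep_vars (\<lambda>s. PiM ({s} \<times> J) (\<lambda>_. borel))
      (\<lambda>s \<omega>. restrict (\<lambda>p. (case p of (s, j) \<Rightarrow> \<beta> s j) \<omega>) ({s} \<times> J)) {..<d}"
    by (rule indep_vars_restrict[OF \<beta>_indep]) (use assms in \<open>auto simp: disjoint_family_on_def\<close>)
  then have "indep_vars (\<lambda>_. PiM J (\<lambda>_. borel)) (\<lambda>s \<omega>. (\<lambda>z. \<lambda>j\<in>J. z (s, j))
      (restrict (\<lambda>p. (case p of (s, j) \<Rightarrow> \<beta> s j) \<omega>) ({s} \<times> J))) {..<d}"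
    by (rule indep_vars_compose2) (intro measurable_restrict measurable_component_singleton; simp)
  then show ?thesis by (simp cong: restrict_cong)
qed

lemma indep_\<beta>_within_column:
  assumes "s < d" "J \<subseteq> {1..}"
  shows "indep_vars (\<lambda>_. borel) (\<beta> s) J"
proof -
  have ind: "indep_vars (\<lambda>j. PiM {(s, j)} (\<lambda>_. borel))
      (\<lambda>j \<omega>. restrict (\<lambda>p. (case p of (s, j) \<Rightarrow> \<beta> s j) \<omega>) {(s, j)}) J"
    by (rule indep_vars_restrict[OF \<beta>_indep]) (use assms in \<open>auto simp: disjoint_family_on_def\<close>)
  have "indep_vars (\<lambda>_. borel) (\<lambda>j \<omega>. (\<lambda>z. z (s, j))
      (restrict (\<lambda>p. (case p of (s, j) \<Rightarrow> \<beta> s j) \<omega>) {(s, j)})) J"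
    by (rule indep_vars_compose2[OF ind]) auto
  then show ?thesis by simp
qed

text \<open>The factors lie in different columns and so are independent even if entries of
  \<open>k\<close> coincide; the integrability of the squared product then follows factor by
  factor.\<close>

lemma prod_\<beta>_square_integrable:
  assumes "\<And>s. s < d \<Longrightarrow> 1 \<le> k s"
  shows "(\<lambda>\<omega>. \<Prod>s<d. \<beta> s (k s) \<omega>) \<in> borel_measurable Q"
    and "integrable Q (\<lambda>\<omega>. (\<Prod>s<d. \<beta> s (k s) \<omega>)\<^sup>2)"
proof -
  show "(\<lambda>\<omega>. \<Prod>s<d. \<beta> s (k s) \<omega>) \<in> borel_measurable Q"
    using assms by (auto intro!: borel_measurable_prod \<beta>_measurable)
  have "indep_vars (\<lambda>_. PiM (k ` {..<d}) (\<lambda>_. borel)) (\<lambda>s \<omega>. \<lambda>j\<in>k ` {..<d}. \<beta> s j \<omega>) {..<d}"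
    using assms by (intro indep_\<beta>_columns) auto
  then have "indep_vars (\<lambda>_. borel) (\<lambda>s \<omega>. (\<lambda>z. (z (k s))\<^sup>2) (\<lambda>j\<in>k ` {..<d}. \<beta> s j \<omega>)) {..<d}"
    by (rule indep_vars_compose2)
       (intro borel_measurable_power measurable_component_singleton; auto)
  then have "indep_vars (\<lambda>_. borel) (\<lambda>s \<omega>. (\<beta> s (k s) \<omega>)\<^sup>2) {..<d}"
    by (subst indep_vars_cong[OF refl _ refl]) auto
  then have "integrable Q (\<lambda>\<omega>. \<Prod>s<d. (\<beta> s (k s) \<omega>)\<^sup>2)"
    by (rule indep_vars_integrable[rotated]) (use assms in \<open>auto intro!: \<beta>_second_moment\<close>)
  then show "integrable Q (\<lambda>\<omega>. (\<Prod>s<d. \<beta> s (k s) \<omega>)\<^sup>2)"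
    by (simp add: prod_power_distrib)
qed

end

subsection \<open>Convergence for finitely many products\<close>

context tensor_columns
begin

text \<open>These facts supply what the uniform convergence and replacement lemmas ask of the
  sampled block. The limit is the Cramer-Wold reduction: a linear combination of normalized sums is
  the normalized sum of \<open>h\<close>, whose variance is the sum of the
  \<open>(a j)\<^sup>2\<close> by orthonormality.\<close>

lemma lin_char_norm_sum:
  assumes s: "s < d" and J: "finite J" "\<And>j. j \<in> J \<Longrightarrow> 1 \<le> j \<and> enat j \<le> Mb"
  defines "A \<equiv> \<lambda>n. distr P (PiM J (\<lambda>_. borel)) (\<lambda>\<omega>. \<lambda>j\<in>J. norm_sum \<xi> (g s j) s n \<omega>)"
  shows "prob_space (A n)" and "sets (A n) = sets (PiM J (\<lambda>_. borel))"
    and "j \<in> J \<Longrightarrow> integrable (A n) (\<lambda>y. y j)"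
    and "j \<in> J \<Longrightarrow> (\<integral>y. \<bar>y j\<bar> \<partial>A n) \<le> 1"
    and "(\<lambda>n. lin_char (A n) J a) \<longlonglongrightarrow> exp (- (\<Sum>j\<in>J. (a j)\<^sup>2) / 2)"
proof -
  have U: "norm_sum \<xi> (g s j) s n \<in> borel_measurable P" if "j \<in> J" for j n
    using that J s by (intro measurable_norm_sum g_meas) auto
  then have V: "(\<lambda>\<omega>. \<lambda>j\<in>J. norm_sum \<xi> (g s j) s n \<omega>) \<in> measurable P (PiM J (\<lambda>_. borel))" for n
    by (intro measurable_restrict)
  show "prob_space (A n)" unfolding A_def by (rule prob_space_distr[OF V])
  show "sets (A n) = sets (PiM J (\<lambda>_. borel))" by (simp add: A_def)
  have U2: "integrable P (\<lambda>\<omega>. (norm_sum \<xi> (g s j) s n \<omega>)\<^sup>2)"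
    "expectation (\<lambda>\<omega>. (norm_sum \<xi> (g s j) s n \<omega>)\<^sup>2) \<le> 1" if j: "j \<in> J" for j n
  proof -
    note cov = norm_sum_covariance[OF s g_meas g_meas g_sq g_sq g_centered g_centered, of j j n]
    show "integrable P (\<lambda>\<omega>. (norm_sum \<xi> (g s j) s n \<omega>)\<^sup>2)"
      using cov(1) J j s by (simp add: power2_eq_square)
    show "expectation (\<lambda>\<omega>. (norm_sum \<xi> (g s j) s n \<omega>)\<^sup>2) \<le> 1"
    \<comment> \<open>The empty sum has second moment 0, so the bound by 1 holds for every
      \<open>n\<close>, while equality would fail here.\<close>
    proof (cases "n = 0")
      case True
      then show ?thesis by (simp add: norm_sum_def)
    next
      case False
      then show ?thesis
        using cov(2) J j s g_orthonormal[of s j j] by (simp add: power2_eq_square)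
    qed
  qed
  show "integrable (A n) (\<lambda>y. y j)" if j: "j \<in> J"
    unfolding A_def using j V U[OF j] U2(1)[OF j]
    by (subst integrable_distr_eq) (auto intro: square_integrable_imp_integrable)
  show "(\<integral>y. \<bar>y j\<bar> \<partial>A n) \<le> 1" if j: "j \<in> J"
  proof -
    have "(\<integral>y. \<bar>y j\<bar> \<partial>A n) = expectation (\<lambda>\<omega>. \<bar>norm_sum \<xi> (g s j) s n \<omega>\<bar>)"
      unfolding A_def using j V by (subst integral_distr) auto
    also have "\<dots> \<le> sqrt (expectation (\<lambda>\<omega>. (norm_sum \<xi> (g s j) s n \<omega>)\<^sup>2))"
      by (rule expectation_abs_le_sqrt[OF U[OF j] U2(1)[OF j]])
    also have "\<dots> \<le> 1" using U2(2)[OF j] by simp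
    finally show ?thesis .
  qed
  define h where "h = (\<lambda>x. \<Sum>j\<in>J. a j * g s j x)"
  have h_sum: "(\<Sum>j\<in>J. a j * norm_sum \<xi> (g s j) s n \<omega>) = norm_sum \<xi> h s n \<omega>" for n \<omega>
  proof -
    have "(\<Sum>i<n. \<Sum>j\<in>J. a j * g s j (\<xi> (Suc i) s \<omega>)) = (\<Sum>j\<in>J. a j * (\<Sum>i<n. g s j (\<xi> (Suc i) s \<omega>)))"
      by (subst sum.swap) (simp add: sum_distrib_left)
    then have "norm_sum \<xi> h s n \<omega> = (\<Sum>j\<in>J. a j * (\<Sum>i<n. g s j (\<xi> (Suc i) s \<omega>))) / sqrt (real n)"
      by (simp add: norm_sum_def h_def)
    then show ?thesis
      unfolding norm_sum_def[of _ "g s _"] by (simp add: sum_divide_distrib[of _ J])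
  qed
  have lin: "lin_char (A n) J a = expectation (\<lambda>\<omega>. iexp (norm_sum \<xi> h s n \<omega>))" for n
  proof -
    have "lin_char (A n) J a = expectation (\<lambda>\<omega>. iexp (\<Sum>j\<in>J. a j * norm_sum \<xi> (g s j) s n \<omega>))"
      unfolding lin_char_def A_def using V by (subst integral_distr) auto
    then show ?thesis by (simp only: h_sum)
  qed
  have Ms: "prob_space (M s)"
    using prob_space_distr[OF measurable_\<xi>[OF le_refl s]] law[OF le_refl s] by simp
  have g_int: "integrable (M s) (g s j)" if "j \<in> J" for j
    using that J s
    by (auto intro: finite_measure.square_integrable_imp_integrable[OF prob_space.finite_measure[OF Ms] g_meas g_sq])
  have gg_int: "integrable (M s) (\<lambda>x. a j * a j' * (g s j x * g s j' x))" if "j \<in> J" "j' \<in> J" for j j'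
    using that J s
    by (intro Bochner_Integration.integrable_mult_right integrable_mult_of_squares g_meas g_sq) auto
  have h_sq_eq: "(h x)\<^sup>2 = (\<Sum>j\<in>J. \<Sum>j'\<in>J. a j * a j' * (g s j x * g s j' x))" for x
    by (simp add: h_def power2_eq_square sum_product mult_ac)
  have "(\<integral>x. (h x)\<^sup>2 \<partial>M s) = (\<Sum>j\<in>J. \<integral>x. (\<Sum>j'\<in>J. a j * a j' * (g s j x * g s j' x)) \<partial>M s)"
    unfolding h_sq_eq by (intro Bochner_Integration.integral_sum Bochner_Integration.integrable_sum gg_int)
  also have "\<dots> = (\<Sum>j\<in>J. \<Sum>j'\<in>J. \<integral>x. a j * a j' * (g s j x * g s j' x) \<partial>M s)"
    by (intro sum.cong refl Bochner_Integration.integral_sum gg_int)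
  also have "\<dots> = (\<Sum>j\<in>J. \<Sum>j'\<in>J. if j = j' then a j * a j' else 0)"
    using J s by (intro sum.cong refl) (simp add: g_orthonormal)
  also have "\<dots> = (\<Sum>j\<in>J. (a j)\<^sup>2)"
    using J(1) by (simp add: power2_eq_square)
  finally have h_sq: "(\<integral>x. (h x)\<^sup>2 \<partial>M s) = (\<Sum>j\<in>J. (a j)\<^sup>2)" .
  have "(\<lambda>n. expectation (\<lambda>\<omega>. iexp (norm_sum \<xi> h s n \<omega>))) \<longlonglongrightarrow> exp (- (\<integral>x. (h x)\<^sup>2 \<partial>M s) / 2)"
  proof (rule iexp_norm_sum_tendsto[OF s])
    show "h \<in> borel_measurable (M s)"
      unfolding h_def using J s g_meas by auto
    show "integrable (M s) (\<lambda>x. (h x)\<^sup>2)"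
      unfolding h_sq_eq by (intro Bochner_Integration.integrable_sum gg_int)
    show "integral\<^sup>L (M s) h = 0"
      unfolding h_def using g_int J s g_centered by (simp add: Bochner_Integration.integral_sum)
  qed
  then show "(\<lambda>n. lin_char (A n) J a) \<longlonglongrightarrow> exp (- (\<Sum>j\<in>J. (a j)\<^sup>2) / 2)"
    by (simp only: lin h_sq)
qed

end

text \<open>The Gaussian counterpart of \<open>lin_char_norm_sum\<close>; its characteristic
  function is exactly the limit found there.\<close>

lemma (in gaussian_columns) lin_char_\<beta>:
  assumes s: "s < d" and J: "J \<subseteq> {1..}"
  defines "B \<equiv> distr Q (PiM J (\<lambda>_. borel)) (\<lambda>\<omega>. \<lambda>j\<in>J. \<beta> s j \<omega>)"
  shows "prob_space B" and "sets B = sets (PiM J (\<lambda>_. borel))"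
    and "j \<in> J \<Longrightarrow> integrable B (\<lambda>y. y j)"
    and "j \<in> J \<Longrightarrow> (\<integral>y. \<bar>y j\<bar> \<partial>B) \<le> 1"
    and "lin_char B J a = exp (- (\<Sum>j\<in>J. (a j)\<^sup>2) / 2)"
proof -
  have m: "\<beta> s j \<in> borel_measurable Q" if "j \<in> J" for j
    using that J s by (intro \<beta>_measurable) auto
  then have V: "(\<lambda>\<omega>. \<lambda>j\<in>J. \<beta> s j \<omega>) \<in> measurable Q (PiM J (\<lambda>_. borel))"
    by (intro measurable_restrict)
  show "prob_space B" unfolding B_def by (rule prob_space_distr[OF V])
  show "sets B = sets (PiM J (\<lambda>_. borel))" by (simp add: B_def)
  have sq: "integrable Q (\<lambda>\<omega>. (\<beta> s j \<omega>)\<^sup>2)" "expectation (\<lambda>\<omega>. (\<beta> s j \<omega>)\<^sup>2) = 1" if "j \<in> J" for j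
    using that J s by (auto intro!: \<beta>_second_moment)
  show "integrable B (\<lambda>y. y j)" if j: "j \<in> J"
    unfolding B_def using j V m[OF j] sq(1)[OF j]
    by (subst integrable_distr_eq) (auto intro: square_integrable_imp_integrable)
  show "(\<integral>y. \<bar>y j\<bar> \<partial>B) \<le> 1" if j: "j \<in> J"
  proof -
    have "(\<integral>y. \<bar>y j\<bar> \<partial>B) = expectation (\<lambda>\<omega>. \<bar>\<beta> s j \<omega>\<bar>)"
      unfolding B_def using j V by (subst integral_distr) auto
    also have "\<dots> \<le> sqrt (expectation (\<lambda>\<omega>. (\<beta> s j \<omega>)\<^sup>2))"
      by (rule expectation_abs_le_sqrt[OF m[OF j] sq(1)[OF j]])
    finally show ?thesis using sq(2)[OF j] by simp
  qed
  have "lin_char B J a = expectation (\<lambda>\<omega>. iexp (\<Sum>j\<in>J. a j * \<beta> s j \<omega>))"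
    unfolding lin_char_def B_def using V by (subst integral_distr) auto
  also have "\<dots> = exp (- (\<Sum>j\<in>J. (a j)\<^sup>2) / 2)"
    using J s by (intro iexp_linear_normal indep_\<beta>_within_column \<beta>_normal) auto
  finally show "lin_char B J a = exp (- (\<Sum>j\<in>J. (a j)\<^sup>2) / 2)" .
qed

context tensor_columns
begin

text \<open>All columns change with \<open>m\<close> at once, yet they can be swapped separately:
  the closeness of one column is uniform in the coefficients, and the remaining blocks enter only
  through first absolute moments bounded by 1.\<close>

lemma iexp_tens_sum_tendsto:
  assumes "gaussian_columns Q d \<beta>" and G: "finite G" "G \<subseteq> idx d Mb"
    and n: "\<And>s. s < d \<Longrightarrow> filterlim (\<lambda>m. n m s) at_top sequentially"
  shows "(\<lambda>m. expectation (\<lambda>\<omega>. iexp (\<Sum>k\<in>G. lam k * tens_sum (n m) k \<omega>)))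
    \<longlonglongrightarrow> (\<integral>\<omega>. iexp (\<Sum>k\<in>G. lam k * (\<Prod>s<d. \<beta> s (k s) \<omega>)) \<partial>Q)"
proof -
  interpret Q: gaussian_columns Q d \<beta> by fact
  define J where "J = (\<Union>k\<in>G. k ` {..<d})"
  have J: "finite J" "\<And>j. j \<in> J \<Longrightarrow> 1 \<le> j \<and> enat j \<le> Mb" and GJ: "\<And>k s. k \<in> G \<Longrightarrow> s < d \<Longrightarrow> k s \<in> J"
    using G by (auto simp: J_def idx_def)
  have J': "J \<subseteq> {1..}" using J(2) by auto
  define A where "A s n = distr P (PiM J (\<lambda>_. borel)) (\<lambda>\<omega>. \<lambda>j\<in>J. norm_sum \<xi> (g s j) s n \<omega>)" for s n
  define B where "B s = distr Q (PiM J (\<lambda>_. borel)) (\<lambda>\<omega>. \<lambda>j\<in>J. \<beta> s j \<omega>)" for s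
  note A = lin_char_norm_sum[OF _ J, folded A_def]
  note B = Q.lin_char_\<beta>[OF _ J', folded B_def]
  have E_P: "expectation (\<lambda>\<omega>. iexp (\<Sum>k\<in>G. lam k * tens_sum (n m) k \<omega>))
      = (\<integral>y. iexp (block_poly G lam {..<d} y) \<partial>PiM {..<d} (\<lambda>s. A s (n m s)))" for m
  proof -
    have ind: "indep_vars (\<lambda>_. PiM J (\<lambda>_. borel)) (\<lambda>s \<omega>. \<lambda>j\<in>J. norm_sum \<xi> (g s j) s (n m s) \<omega>) {..<d}"
      using J by (intro indep_norm_sum_columns g_meas) auto
    have "(\<Sum>k\<in>G. lam k * tens_sum (n m) k \<omega>)
        = (\<Sum>k\<in>G. lam k * (\<Prod>s<d. (\<lambda>j\<in>J. norm_sum \<xi> (g s j) s (n m s) \<omega>) (k s)))" for \<omega>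
      unfolding tens_sum_def using GJ by (intro sum.cong arg_cong2[where f=times] prod.cong refl) simp
    then show ?thesis
      using integral_iexp_block_poly[OF ind d_pos, of G lam] GJ by (simp add: A_def)
  qed
  have E_Q: "(\<integral>\<omega>. iexp (\<Sum>k\<in>G. lam k * (\<Prod>s<d. \<beta> s (k s) \<omega>)) \<partial>Q)
      = (\<integral>y. iexp (block_poly G lam {..<d} y) \<partial>PiM {..<d} B)"
  proof -
    have "(\<Sum>k\<in>G. lam k * (\<Prod>s<d. \<beta> s (k s) \<omega>))
        = (\<Sum>k\<in>G. lam k * (\<Prod>s<d. (\<lambda>j\<in>J. \<beta> s j \<omega>) (k s)))" for \<omega>
      using GJ by (intro sum.cong arg_cong2[where f=times] prod.cong refl) simp
    then show ?thesis
      using Q.integral_iexp_block_poly[OF Q.indep_\<beta>_columns[OF J'] d_pos, of G lam] GJ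
      by (simp add: B_def[abs_def])
  qed
  show ?thesis
    unfolding E_P E_Q
  proof (rule metric_LIMSEQ_I, unfold dist_norm)
    fix r :: real assume r: "0 < r"
    \<comment> \<open>The \<open>d\<close> swaps cost \<open>\<epsilon> * K\<close> in total, so
      \<open>\<epsilon> = r / (2 * K)\<close> makes the error \<open>r / 2\<close>.\<close>
    define K where "K = real d * (1 + (\<Sum>k\<in>G. \<bar>lam k\<bar>))"
    have K: "0 < K" using d_pos by (auto simp: K_def intro!: mult_pos_pos add_pos_nonneg sum_nonneg)
    define \<epsilon> where "\<epsilon> = r / (2 * K)"
    have \<epsilon>: "0 < \<epsilon>" using r K by (simp add: \<epsilon>_def)
    \<comment> \<open>The threshold is sought in the column's own length \<open>n\<close>; it is
      composed with \<open>n m s\<close> only later, so no common growth rate is imposed.\<close>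
    have "\<exists>N. \<forall>n\<ge>N. \<forall>a. norm (lin_char (A s n) J a - lin_char (B s) J a) \<le> \<epsilon> + \<epsilon> * (\<Sum>j\<in>J. \<bar>a j\<bar>)"
      if s: "s < d" for s
    proof (rule pointwise_lipschitz_imp_uniform[OF J(1) _ _ _ _ _ \<epsilon>])
      show "(\<lambda>n. lin_char (A s n) J a) \<longlonglongrightarrow> lin_char (B s) J a" for a
        using A(5)[OF s] B(5)[OF s] by simp
    next
      fix n a b
      show "norm (lin_char (A s n) J a - lin_char (A s n) J b) \<le> (\<Sum>j\<in>J. \<bar>a j - b j\<bar>)"
        by (rule norm_lin_char_diff_le[OF A(1,2,3,4)[OF s]])
      show "norm (lin_char (B s) J a - lin_char (B s) J b) \<le> (\<Sum>j\<in>J. \<bar>a j - b j\<bar>)"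
        by (rule norm_lin_char_diff_le[OF B(1,2,3,4)[OF s]])
      show "norm (lin_char (A s n) J a) \<le> 1"
        by (rule norm_lin_char_le_1[OF A(1,2)[OF s]])
      show "norm (lin_char (B s) J a) \<le> 1"
        by (rule norm_lin_char_le_1[OF B(1,2)[OF s]])
    qed
    then have "\<exists>N. \<forall>s. s < d \<longrightarrow> (\<forall>n\<ge>N s. \<forall>a.
        norm (lin_char (A s n) J a - lin_char (B s) J a) \<le> \<epsilon> + \<epsilon> * (\<Sum>j\<in>J. \<bar>a j\<bar>))"
      by (intro choice allI) blast
    then obtain N where N: "\<And>s n a. s < d \<Longrightarrow> n \<ge> N s \<Longrightarrow>
        norm (lin_char (A s n) J a - lin_char (B s) J a) \<le> \<epsilon> + \<epsilon> * (\<Sum>j\<in>J. \<bar>a j\<bar>)"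
      by blast
    have "\<forall>\<^sub>F m in sequentially. \<forall>s\<in>{..<d}. N s \<le> n m s"
      using n by (intro eventually_ball_finite) (auto simp: filterlim_at_top)
    then obtain m0 where m0: "\<And>m s. m \<ge> m0 \<Longrightarrow> s < d \<Longrightarrow> N s \<le> n m s"
      unfolding eventually_sequentially by auto
    have "norm ((\<integral>y. iexp (block_poly G lam {..<d} y) \<partial>PiM {..<d} (\<lambda>s. A s (n m s)))
        - (\<integral>y. iexp (block_poly G lam {..<d} y) \<partial>PiM {..<d} B)) < r" if m: "m \<ge> m0" for m
    proof -
      have "norm ((\<integral>y. iexp (block_poly G lam {..<d} y) \<partial>PiM {..<d} (\<lambda>s. A s (n m s)))
          - (\<integral>y. iexp (block_poly G lam {..<d} y) \<partial>PiM {..<d} B))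
          \<le> real d * (\<epsilon> + \<epsilon> * (\<Sum>k\<in>G. \<bar>lam k\<bar>))"
      proof (rule block_replace_all[OF J(1) G(1)])
        show "k s \<in> J" if "k \<in> G" "s < d" for k s
          using GJ that .
        show "norm (lin_char (A s (n m s)) J a - lin_char (B s) J a) \<le> \<epsilon> + \<epsilon> * (\<Sum>j\<in>J. \<bar>a j\<bar>)"
          if "s < d" for s a
          by (rule N[OF that m0[OF m that]])
      qed (simp_all add: A(1-4) B(1-4) \<epsilon> less_imp_le)
      also have "\<dots> = \<epsilon> * K" by (simp add: K_def algebra_simps)
      also have "\<dots> < r" using r K by (simp add: \<epsilon>_def)
      finally show ?thesis .
    qed
    then show "\<exists>m0. \<forall>m\<ge>m0. norm ((\<integral>y. iexp (block_poly G lam {..<d} y) \<partial>PiM {..<d} (\<lambda>s. A s (n m s)))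
        - (\<integral>y. iexp (block_poly G lam {..<d} y) \<partial>PiM {..<d} B)) < r"
      by blast
  qed
qed

section \<open>L2 error of truncating the expansion, uniformly in the box\<close>

lemma tens_measurable:
  assumes k: "k \<in> idx d Mb"
  shows "tens d g k \<in> borel_measurable (PiM {..<d} M)"
  unfolding tens_def[abs_def]
proof (intro borel_measurable_prod)
  fix s assume s: "s \<in> {..<d}"
  have "g s (k s) \<in> borel_measurable (M s)"
    using s by (intro g_meas idxD[OF k]) auto
  then show "(\<lambda>x. g s (k s) (x s)) \<in> borel_measurable (PiM {..<d} M)"
    using measurable_compose[OF measurable_component_singleton[OF s]] by blast
qed

text \<open>On the box with all sides 1 the tensor sum is the tensor itself evaluated at a point of
  law \<open>PiM {..<d} M\<close>, so integrability is read off from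
  \<open>tens_sum_orthonormal\<close>.\<close>

lemma tens_square_integrable:
  assumes k: "k \<in> idx d Mb"
  shows "integrable (PiM {..<d} M) (\<lambda>x. (tens d g k x)\<^sup>2)"
proof -
  have "tens d g k (\<lambda>s\<in>{..<d}. \<xi> 1 s \<omega>) = tens_sum (\<lambda>_. 1) k \<omega>" for \<omega>
    by (simp add: tens_def tens_sum_def norm_sum_def)
  then show ?thesis
    using integrable_distr_eq[OF distr_point(1)[of "\<lambda>_. 1"], where f="\<lambda>x. (tens d g k x)\<^sup>2"]
      distr_point(2)[of "\<lambda>_. 1"] tens_measurable[OF k] tens_sum_orthonormal(1)[OF k k, of "\<lambda>_. 1"]
    by (simp add: power2_eq_square)
qed

text \<open>The error splits into \<open>SL\<close> of the remainder \<open>h\<close> after the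
  larger finite set \<open>G'\<close>, and the finite sum \<open>b\<close> over
  \<open>G' - G\<close>. The crude bound handles \<open>h\<close>, Parseval and the coefficient tail
  handle \<open>b\<close>, each giving at most \<open>\<eta>\<close>. Although \<open>G'\<close>
  depends on the box, the result does not; the 4 comes from bounding the square of a sum by twice
  the sum of squares.\<close>

lemma SL_truncation_error:
  assumes f: "f \<in> borel_measurable (PiM {..<d} M)" "integrable (PiM {..<d} M) (\<lambda>x. (f x)\<^sup>2)"
    and series: "\<And>\<epsilon>. \<epsilon> > 0 \<Longrightarrow> \<exists>F0. finite F0 \<and> F0 \<subseteq> idx d Mb \<and>
         (\<forall>G. finite G \<and> F0 \<subseteq> G \<and> G \<subseteq> idx d Mb \<longrightarrow>
            (\<integral>x. (f x - (\<Sum>k\<in>G. lam k * tens d g k x))\<^sup>2 \<partial>PiM {..<d} M) < \<epsilon>)"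
    and G: "finite G" "G \<subseteq> idx d Mb"
    and tail: "\<And>D. finite D \<Longrightarrow> D \<subseteq> idx d Mb - G \<Longrightarrow> (\<Sum>k\<in>D. (lam k)\<^sup>2) \<le> \<eta>"
    and \<eta>: "0 < \<eta>" and n: "\<And>s. s < d \<Longrightarrow> 1 \<le> n s"
  shows "integrable P (\<lambda>\<omega>. (SL d \<xi> f (box_idx d n) \<omega> - (\<Sum>k\<in>G. lam k * tens_sum n k \<omega>))\<^sup>2)"
    and "expectation (\<lambda>\<omega>. (SL d \<xi> f (box_idx d n) \<omega> - (\<Sum>k\<in>G. lam k * tens_sum n k \<omega>))\<^sup>2) \<le> 4 * \<eta>"
proof -
  define L where "L = box_idx d n"
  have L: "finite L" "\<And>\<kappa> s. \<kappa> \<in> L \<Longrightarrow> s < d \<Longrightarrow> 1 \<le> \<kappa> s"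
    by (simp add: L_def finite_box_idx) (auto simp: L_def box_idx_def)
  have card: "0 < real (card L)"
    using n by (auto simp: L_def card_box_idx Suc_le_eq intro!: prod_pos)
  \<comment> \<open>Dividing by \<open>card L\<close> compensates in advance for the factor in
    \<open>SL_second_moment_le\<close>.\<close>
  then have "0 < \<eta> / real (card L)" using \<eta> by simp
  from series[OF this] obtain F0 where F0: "finite F0 \<and> F0 \<subseteq> idx d Mb \<and>
    (\<forall>G. finite G \<and> F0 \<subseteq> G \<and> G \<subseteq> idx d Mb \<longrightarrow>
      (\<integral>x. (f x - (\<Sum>k\<in>G. lam k * tens d g k x))\<^sup>2 \<partial>PiM {..<d} M) < \<eta> / real (card L))" ..
  define G' where "G' = G \<union> F0"
  have G': "finite G'" "G' \<subseteq> idx d Mb" "G \<subseteq> G'"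
    using G F0 by (auto simp: G'_def)
  define h where "h = (\<lambda>x. f x - (\<Sum>k\<in>G'. lam k * tens d g k x))"
  define b where "b = (\<lambda>\<omega>. \<Sum>k\<in>G' - G. lam k * tens_sum n k \<omega>)"
  have h_meas: "h \<in> borel_measurable (PiM {..<d} M)"
    unfolding h_def using f(1) tens_measurable G'
    by (auto intro!: borel_measurable_diff borel_measurable_sum borel_measurable_times)
  \<comment> \<open>Integrability needs its own argument: the Bochner integral of a non-integrable
    function is 0, so the smallness in \<open>series\<close> does not imply it.\<close>
  have h_sq: "integrable (PiM {..<d} M) (\<lambda>x. (h x)\<^sup>2)"
  proof -
    let ?S = "\<lambda>x. \<Sum>k\<in>G'. lam k * tens d g k x"
    have S_meas: "?S \<in> borel_measurable (PiM {..<d} M)"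
      using tens_measurable G' by (auto intro!: borel_measurable_sum borel_measurable_times)
    have "integrable (PiM {..<d} M) (\<lambda>x. \<Sum>k\<in>G'. \<Sum>k'\<in>G'. lam k * lam k' * (tens d g k x * tens d g k' x))"
      using G' by (intro Bochner_Integration.integrable_sum Bochner_Integration.integrable_mult_right
          integrable_mult_of_squares tens_measurable tens_square_integrable) auto
    then have S_sq: "integrable (PiM {..<d} M) (\<lambda>x. (?S x)\<^sup>2)"
      by (simp add: power2_eq_square sum_product mult_ac)
    have "integrable (PiM {..<d} M) (\<lambda>x. (f x)\<^sup>2 + (?S x)\<^sup>2 - 2 * (f x * ?S x))"
      by (intro Bochner_Integration.integrable_diff Bochner_Integration.integrable_add
          Bochner_Integration.integrable_mult_right integrable_mult_of_squares f S_meas S_sq)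
    then show ?thesis by (simp add: h_def power2_diff mult.assoc)
  qed
  have "SL d \<xi> h L \<omega> = SL d \<xi> f L \<omega> - (\<Sum>k\<in>G'. lam k * SL d \<xi> (tens d g k) L \<omega>)" for \<omega>
  proof -
    let ?x = "\<lambda>\<kappa>. \<lambda>s\<in>{..<d}. \<xi> (\<kappa> s) s \<omega>"
    have "(\<Sum>\<kappa>\<in>L. \<Sum>k\<in>G'. lam k * tens d g k (?x \<kappa>)) = (\<Sum>k\<in>G'. lam k * (\<Sum>\<kappa>\<in>L. tens d g k (?x \<kappa>)))"
      by (subst sum.swap) (simp add: sum_distrib_left)
    then show ?thesis
      by (simp add: SL_def h_def sum_subtractf diff_divide_distrib sum_divide_distrib[of _ G'])
  qed
  then have SL_h: "SL d \<xi> h L \<omega> = SL d \<xi> f L \<omega> - (\<Sum>k\<in>G'. lam k * tens_sum n k \<omega>)" for \<omega>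
    by (simp add: L_def SL_tens_box tens_sum_def)
  have split: "SL d \<xi> f (box_idx d n) \<omega> - (\<Sum>k\<in>G. lam k * tens_sum n k \<omega>) = SL d \<xi> h L \<omega> + b \<omega>" for \<omega>
    using sum.subset_diff[OF G'(3,1), of "\<lambda>k. lam k * tens_sum n k \<omega>"]
    by (simp add: SL_h b_def flip: L_def)
  have SL2: "integrable P (\<lambda>\<omega>. (SL d \<xi> h L \<omega>)\<^sup>2)"
    "expectation (\<lambda>\<omega>. (SL d \<xi> h L \<omega>)\<^sup>2) \<le> real (card L) * (\<integral>x. (h x)\<^sup>2 \<partial>PiM {..<d} M)"
    by (rule SL_second_moment_le[OF L(1) _ h_meas h_sq]; rule L(2); assumption)+
  have D: "finite (G' - G)" "G' - G \<subseteq> idx d Mb" using G' by auto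
  have b2: "integrable P (\<lambda>\<omega>. (b \<omega>)\<^sup>2)" "expectation (\<lambda>\<omega>. (b \<omega>)\<^sup>2) = (\<Sum>k\<in>G' - G. (lam k)\<^sup>2)"
    using tens_sum_Parseval[OF D, where lam=lam and n=n] n by (simp_all add: b_def)
  have SL_meas: "SL d \<xi> h L \<in> borel_measurable P"
    by (rule SL_measurable[OF _ h_meas]) (rule L(2))
  have b_meas: "b \<in> borel_measurable P"
    unfolding b_def using D by (auto intro!: borel_measurable_sum borel_measurable_times tens_sum_measurable)
  have "integrable P (\<lambda>\<omega>. (SL d \<xi> h L \<omega>)\<^sup>2 + (b \<omega>)\<^sup>2 + 2 * (SL d \<xi> h L \<omega> * b \<omega>))"
    by (intro Bochner_Integration.integrable_add Bochner_Integration.integrable_mult_right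
          integrable_mult_of_squares SL2(1) b2(1) SL_meas b_meas)
  then show int: "integrable P (\<lambda>\<omega>. (SL d \<xi> f (box_idx d n) \<omega> - (\<Sum>k\<in>G. lam k * tens_sum n k \<omega>))\<^sup>2)"
    unfolding split by (simp add: power2_sum mult.assoc)
  have "expectation (\<lambda>\<omega>. (SL d \<xi> f (box_idx d n) \<omega> - (\<Sum>k\<in>G. lam k * tens_sum n k \<omega>))\<^sup>2)
      \<le> expectation (\<lambda>\<omega>. 2 * (SL d \<xi> h L \<omega>)\<^sup>2 + 2 * (b \<omega>)\<^sup>2)"
  proof (intro integral_mono int Bochner_Integration.integrable_add
      Bochner_Integration.integrable_mult_right SL2(1) b2(1))
    fix \<omega>
    show "(SL d \<xi> f (box_idx d n) \<omega> - (\<Sum>k\<in>G. lam k * tens_sum n k \<omega>))\<^sup>2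
        \<le> 2 * (SL d \<xi> h L \<omega>)\<^sup>2 + 2 * (b \<omega>)\<^sup>2"
      unfolding split using sum_squares_bound[of "SL d \<xi> h L \<omega>" "b \<omega>"] by (simp add: power2_sum)
  qed
  also have "\<dots> = 2 * expectation (\<lambda>\<omega>. (SL d \<xi> h L \<omega>)\<^sup>2) + 2 * expectation (\<lambda>\<omega>. (b \<omega>)\<^sup>2)"
    using SL2(1) b2(1) by simp
  also have "\<dots> \<le> 2 * \<eta> + 2 * \<eta>"
  proof -
    have "(\<integral>x. (h x)\<^sup>2 \<partial>PiM {..<d} M) < \<eta> / real (card L)"
      unfolding h_def using F0 G' by (simp add: G'_def)
    then have "expectation (\<lambda>\<omega>. (SL d \<xi> h L \<omega>)\<^sup>2) \<le> \<eta>"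
      using SL2(2) card by (simp add: field_simps)
    moreover have "expectation (\<lambda>\<omega>. (b \<omega>)\<^sup>2) \<le> \<eta>"
      using b2(2) tail[of "G' - G"] D by auto
    ultimately show ?thesis by simp
  qed
  finally show "expectation (\<lambda>\<omega>. (SL d \<xi> f (box_idx d n) \<omega> - (\<Sum>k\<in>G. lam k * tens_sum n k \<omega>))\<^sup>2) \<le> 4 * \<eta>"
    by simp
qed

end

subsection \<open>Truncation and the limit theorem\<close>

lemma (in prob_space) norm_iexp_scaled_diff_le:
  assumes [measurable]: "X \<in> borel_measurable M" "Y \<in> borel_measurable M"
    and sq: "integrable M (\<lambda>x. (X x - Y x)\<^sup>2)" and le: "(\<integral>x. (X x - Y x)\<^sup>2 \<partial>M) \<le> c\<^sup>2" and c: "0 \<le> c"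
  shows "norm ((\<integral>x. iexp (t * X x) \<partial>M) - (\<integral>x. iexp (t * Y x) \<partial>M)) \<le> \<bar>t\<bar> * c"
proof -
  have eq: "t * X x - t * Y x = t * (X x - Y x)" for x by (simp add: algebra_simps)
  have int: "integrable M (\<lambda>x. X x - Y x)"
    by (rule square_integrable_imp_integrable[OF _ sq]) simp
  have "norm ((\<integral>x. iexp (t * X x) \<partial>M) - (\<integral>x. iexp (t * Y x) \<partial>M))
      \<le> (\<integral>x. \<bar>t * X x - t * Y x\<bar> \<partial>M)"
    using int by (intro norm_integral_iexp_diff_le) (auto simp: eq)
  also have "\<dots> = \<bar>t\<bar> * (\<integral>x. \<bar>X x - Y x\<bar> \<partial>M)"
    by (simp add: eq abs_mult)
  also have "(\<integral>x. \<bar>X x - Y x\<bar> \<partial>M) \<le> sqrt (\<integral>x. (X x - Y x)\<^sup>2 \<partial>M)"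
    by (rule expectation_abs_le_sqrt[OF _ sq]) simp
  also have "\<dots> \<le> c" using le c by (simp add: real_le_lsqrt)
  finally show ?thesis by (simp add: mult_left_mono)
qed

text \<open>By nonnegativity, \<open>sum f F + sum f D\<close> stays below the total when
  \<open>D\<close> avoids \<open>F\<close>, so \<open>D\<close> carries at most what
  \<open>F\<close> misses. Restricting to finite \<open>D\<close> matches the finite Parseval
  identity.\<close>

lemma summable_on_small_tail:
  fixes f :: "'a \<Rightarrow> real"
  assumes f: "f summable_on A" and nonneg: "\<And>x. x \<in> A \<Longrightarrow> 0 \<le> f x" and \<eta>: "0 < \<eta>"
  obtains F where "finite F" "F \<subseteq> A" "\<And>D. finite D \<Longrightarrow> D \<subseteq> A - F \<Longrightarrow> sum f D \<le> \<eta>"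
proof -
  have "(sum f \<longlongrightarrow> infsum f A) (finite_subsets_at_top A)"
    using has_sum_infsum[OF f] by (simp add: has_sum_def)
  from tendstoD[OF this \<eta>] obtain F where F: "finite F \<and> F \<subseteq> A \<and>
    (\<forall>Y. finite Y \<and> F \<subseteq> Y \<and> Y \<subseteq> A \<longrightarrow> dist (sum f Y) (infsum f A) < \<eta>)"
    unfolding eventually_finite_subsets_at_top ..
  show ?thesis
  proof (rule that[of F])
    show "finite F" "F \<subseteq> A" using F by auto
    fix D assume D: "finite D" "D \<subseteq> A - F"
    have "sum f F + sum f D = sum f (F \<union> D)"
      using F D by (subst sum.union_disjoint) auto
    also have "\<dots> \<le> infsum f A"
      using F D nonneg by (intro finite_sum_le_infsum f) auto
    moreover have "dist (sum f F) (infsum f A) < \<eta>" using F by blast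
    ultimately show "sum f D \<le> \<eta>"
      unfolding dist_real_def by linarith
  qed
qed

theorem theorem5p2:
  fixes d :: nat and Mb :: enat
    and M :: "nat \<Rightarrow> 'a measure"
    and g :: "nat \<Rightarrow> nat \<Rightarrow> 'a \<Rightarrow> real"
    and lam :: "(nat \<Rightarrow> nat) \<Rightarrow> real"
    and f :: "(nat \<Rightarrow> 'a) \<Rightarrow> real"
    and P :: "'b measure" and \<xi> :: "nat \<Rightarrow> nat \<Rightarrow> 'b \<Rightarrow> 'a"
    and Q :: "'c measure" and \<beta> :: "nat \<Rightarrow> nat \<Rightarrow> 'c \<Rightarrow> real" and Sinf :: "'c \<Rightarrow> real"
  assumes d: "2 \<le> d"
    and probM: "\<And>s. s < d \<Longrightarrow> prob_space (M s)"
    and g_meas: "\<And>s j. s < d \<Longrightarrow> 1 \<le> j \<Longrightarrow> enat j \<le> Mb \<Longrightarrow> g s j \<in> borel_measurable (M s)"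
    and g_sq: "\<And>s j. s < d \<Longrightarrow> 1 \<le> j \<Longrightarrow> enat j \<le> Mb \<Longrightarrow> integrable (M s) (\<lambda>x. (g s j x)\<^sup>2)"
    and g_centered: "\<And>s j. s < d \<Longrightarrow> 1 \<le> j \<Longrightarrow> enat j \<le> Mb \<Longrightarrow> integral\<^sup>L (M s) (g s j) = 0"
    and g_orthonormal: "\<And>s j j'. s < d \<Longrightarrow> 1 \<le> j \<Longrightarrow> enat j \<le> Mb \<Longrightarrow> 1 \<le> j' \<Longrightarrow> enat j' \<le> Mb \<Longrightarrow>
         (\<integral>x. g s j x * g s j' x \<partial>M s) = (if j = j' then 1 else 0)"
    and lam_sq: "(\<lambda>k. (lam k)\<^sup>2) summable_on idx d Mb"
    and f_meas: "f \<in> borel_measurable (PiM {..<d} M)"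
    and f_sq: "integrable (PiM {..<d} M) (\<lambda>x. (f x)\<^sup>2)"
    and f_series: "\<And>\<epsilon>. \<epsilon> > 0 \<Longrightarrow> \<exists>F0. finite F0 \<and> F0 \<subseteq> idx d Mb \<and>
         (\<forall>G. finite G \<and> F0 \<subseteq> G \<and> G \<subseteq> idx d Mb \<longrightarrow>
            (\<integral>x. (f x - (\<Sum>k\<in>G. lam k * tens d g k x))\<^sup>2 \<partial>PiM {..<d} M) < \<epsilon>)"
    and W: "Wd M d f 2 < \<infinity>"
    and probP: "prob_space P"
    and \<xi>_indep: "prob_space.indep_vars P (\<lambda>(i, s). M s) (\<lambda>(i, s). \<xi> i s) ({1..} \<times> {..<d})"
    and \<xi>_law: "\<And>i s. 1 \<le> i \<Longrightarrow> s < d \<Longrightarrow> distr P (M s) (\<xi> i s) = M s"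
    and probQ: "prob_space Q"
    and \<beta>_indep: "prob_space.indep_vars Q (\<lambda>_. borel) (\<lambda>(s, j). \<beta> s j) ({..<d} \<times> {1..})"
    and \<beta>_normal: "\<And>s j. s < d \<Longrightarrow> 1 \<le> j \<Longrightarrow> distributed Q lborel (\<beta> s j) std_normal_density"
    and Sinf_meas: "Sinf \<in> borel_measurable Q"
    and Sinf_sq: "integrable Q (\<lambda>\<omega>. (Sinf \<omega>)\<^sup>2)"
    and Sinf_series: "\<And>\<epsilon>. \<epsilon> > 0 \<Longrightarrow> \<exists>F0. finite F0 \<and> F0 \<subseteq> idx d Mb \<and>
         (\<forall>G. finite G \<and> F0 \<subseteq> G \<and> G \<subseteq> idx d Mb \<longrightarrow>
            (\<integral>\<omega>. (Sinf \<omega> - (\<Sum>k\<in>G. lam k * (\<Prod>s<d. \<beta> s (k s) \<omega>)))\<^sup>2 \<partial>Q) < \<epsilon>)"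
  shows "\<forall>nseq :: nat \<Rightarrow> nat \<Rightarrow> nat.
           filterlim (\<lambda>j. MIN l\<in>{..<d}. nseq j l) at_top sequentially \<longrightarrow>
           weak_conv_m (\<lambda>j. distr P borel (SL d \<xi> f (box_idx d (nseq j)))) (distr Q borel Sinf)"
proof (intro allI impI)
  fix nseq :: "nat \<Rightarrow> nat \<Rightarrow> nat"
  assume lim: "filterlim (\<lambda>j. MIN l\<in>{..<d}. nseq j l) at_top sequentially"
  interpret P: prob_space P by (rule probP)
  interpret Q: prob_space Q by (rule probQ)
  interpret T: tensor_columns P d M \<xi> Mb g
  proof unfold_locales
    show "0 < d" using d by simp
  qed (fact \<xi>_indep \<xi>_law g_meas g_sq g_centered g_orthonormal)+
  interpret N: gaussian_columns Q d \<beta>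
    by unfold_locales (fact \<beta>_indep \<beta>_normal)+
  have n_lim: "filterlim (\<lambda>j. nseq j s) at_top sequentially" if s: "s < d" for s
    using lim
  proof (rule filterlim_at_top_mono, intro always_eventually allI)
    show "(MIN l\<in>{..<d}. nseq j l) \<le> nseq j s" for j
      using s by (intro Min_le) auto
  qed
  \<comment> \<open>Orthonormality requires nonempty sides, which the divergence of the minimum
    guarantees eventually.\<close>
  have n_pos: "\<forall>\<^sub>F j in sequentially. \<forall>s\<in>{..<d}. 1 \<le> nseq j s"
    using n_lim by (intro eventually_ball_finite) (auto simp: filterlim_at_top)
  have SL_meas: "SL d \<xi> f (box_idx d n) \<in> borel_measurable P" for n
    by (rule T.SL_measurable[OF _ f_meas]) (auto simp: box_idx_def)
  let ?S = "\<lambda>j. SL d \<xi> f (box_idx d (nseq j))"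
  show "weak_conv_m (\<lambda>j. distr P borel (?S j)) (distr Q borel Sinf)"
  proof (rule levy_continuity)
    show "real_distribution (distr P borel (?S j))" for j
      by (rule P.real_distribution_distr[OF SL_meas])
    show "real_distribution (distr Q borel Sinf)"
      by (rule Q.real_distribution_distr[OF Sinf_meas])
    fix t
    have char_S: "char (distr P borel (?S j)) t = (\<integral>\<omega>. iexp (t * ?S j \<omega>) \<partial>P)" for j
      unfolding char_def using SL_meas by (subst integral_distr) auto
    have char_inf: "char (distr Q borel Sinf) t = (\<integral>\<omega>. iexp (t * Sinf \<omega>) \<partial>Q)"
      unfolding char_def using Sinf_meas by (subst integral_distr) auto
    show "(\<lambda>j. char (distr P borel (?S j)) t) \<longlonglongrightarrow> char (distr Q borel Sinf) t"
      unfolding char_S char_inf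
    proof (rule tendstoI, unfold dist_norm)
      fix r :: real assume r: "0 < r"
      \<comment> \<open>The truncation bound \<open>4 * c\<^sup>2\<close> is the square of
        \<open>2 * c\<close>, so a third of \<open>r\<close> must dominate
        \<open>\<bar>t\<bar> * (2 * c)\<close>; the \<open>+ 1\<close> covers
        \<open>t = 0\<close>.\<close>
      define c where "c = r / (6 * (\<bar>t\<bar> + 1))"
      have c: "0 < c" using r by (simp add: c_def)
      have tc: "\<bar>t\<bar> * (2 * c) \<le> r / 3"
        using r by (simp add: c_def divide_le_eq field_simps)
      obtain F1 where F1: "finite F1" "F1 \<subseteq> idx d Mb"
        "\<And>D. finite D \<Longrightarrow> D \<subseteq> idx d Mb - F1 \<Longrightarrow> (\<Sum>k\<in>D. (lam k)\<^sup>2) \<le> c\<^sup>2"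
        using summable_on_small_tail[OF lam_sq, of "c\<^sup>2"] c by auto
      have "0 < c\<^sup>2" using c by simp
      from Sinf_series[OF this] obtain F2 where F2: "finite F2 \<and> F2 \<subseteq> idx d Mb \<and>
        (\<forall>G. finite G \<and> F2 \<subseteq> G \<and> G \<subseteq> idx d Mb \<longrightarrow>
            (\<integral>\<omega>. (Sinf \<omega> - (\<Sum>k\<in>G. lam k * (\<Prod>s<d. \<beta> s (k s) \<omega>)))\<^sup>2 \<partial>Q) < c\<^sup>2)" ..
      \<comment> \<open>\<open>F1\<close> controls the coefficient tail needed for
        \<open>?S\<close>, and \<open>F2\<close> the approximation of \<open>Sinf\<close>. Both
        properties persist for larger finite index sets, so one \<open>G\<close> serves both
        sides.\<close>
      define G where "G = F1 \<union> F2"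
      have G: "finite G" "G \<subseteq> idx d Mb" using F1 F2 by (auto simp: G_def)
      let ?SG = "\<lambda>j \<omega>. \<Sum>k\<in>G. lam k * T.tens_sum (nseq j) k \<omega>"
      let ?SQ = "\<lambda>\<omega>. \<Sum>k\<in>G. lam k * (\<Prod>s<d. \<beta> s (k s) \<omega>)"
      have SG_meas: "?SG j \<in> borel_measurable P" for j
        using G by (auto intro!: borel_measurable_sum borel_measurable_times T.tens_sum_measurable)
      have left: "norm ((\<integral>\<omega>. iexp (t * ?S j \<omega>) \<partial>P) - (\<integral>\<omega>. iexp (t * ?SG j \<omega>) \<partial>P)) \<le> r / 3"
        if n: "\<forall>s\<in>{..<d}. 1 \<le> nseq j s" for j
      proof -
        have tail: "(\<Sum>k\<in>D. (lam k)\<^sup>2) \<le> c\<^sup>2" if "finite D" "D \<subseteq> idx d Mb - G" for D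
          using that by (intro F1(3)) (auto simp: G_def)
        note err = T.SL_truncation_error[OF f_meas f_sq f_series G tail \<open>0 < c\<^sup>2\<close>, of "nseq j"]
        have "norm ((\<integral>\<omega>. iexp (t * ?S j \<omega>) \<partial>P) - (\<integral>\<omega>. iexp (t * ?SG j \<omega>) \<partial>P)) \<le> \<bar>t\<bar> * (2 * c)"
          using err n c by (intro P.norm_iexp_scaled_diff_le SL_meas SG_meas) (auto simp: power_mult_distrib)
        then show ?thesis using tc by linarith
      qed
      have prod_\<beta>: "(\<lambda>\<omega>. \<Prod>s<d. \<beta> s (k s) \<omega>) \<in> borel_measurable Q"
        "integrable Q (\<lambda>\<omega>. (\<Prod>s<d. \<beta> s (k s) \<omega>)\<^sup>2)" if "k \<in> G" for k
        using that G by (intro N.prod_\<beta>_square_integrable T.idxD(1)[of k]; blast)+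
      have SQ_meas: "?SQ \<in> borel_measurable Q"
        using prod_\<beta>(1) by (auto intro!: borel_measurable_sum borel_measurable_times)
      have "integrable Q (\<lambda>\<omega>. \<Sum>k\<in>G. \<Sum>k'\<in>G. lam k * lam k' *
          ((\<Prod>s<d. \<beta> s (k s) \<omega>) * (\<Prod>s<d. \<beta> s (k' s) \<omega>)))"
        by (intro Bochner_Integration.integrable_sum Bochner_Integration.integrable_mult_right
            integrable_mult_of_squares prod_\<beta>)
      then have SQ_sq: "integrable Q (\<lambda>\<omega>. (?SQ \<omega>)\<^sup>2)"
        by (simp add: power2_eq_square sum_product mult_ac)
      have "integrable Q (\<lambda>\<omega>. (Sinf \<omega>)\<^sup>2 + (?SQ \<omega>)\<^sup>2 - 2 * (Sinf \<omega> * ?SQ \<omega>))"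
        by (intro Bochner_Integration.integrable_diff Bochner_Integration.integrable_add
            Bochner_Integration.integrable_mult_right integrable_mult_of_squares
            Sinf_meas Sinf_sq SQ_meas SQ_sq)
      \<comment> \<open>As for the remainder of \<open>f\<close>, the bound on the integral says
        nothing about integrability, which is therefore derived from the two square-integrable
        terms.\<close>
      then have diff_sq: "integrable Q (\<lambda>\<omega>. (Sinf \<omega> - ?SQ \<omega>)\<^sup>2)"
        by (simp add: power2_diff mult.assoc)
      have "(\<integral>\<omega>. (Sinf \<omega> - ?SQ \<omega>)\<^sup>2 \<partial>Q) \<le> c\<^sup>2"
        using F2 G by (intro less_imp_le) (auto simp: G_def)
      then have "norm ((\<integral>\<omega>. iexp (t * Sinf \<omega>) \<partial>Q) - (\<integral>\<omega>. iexp (t * ?SQ \<omega>) \<partial>Q)) \<le> \<bar>t\<bar> * c"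
        using c by (intro Q.norm_iexp_scaled_diff_le Sinf_meas SQ_meas diff_sq) auto
      also have "\<dots> \<le> \<bar>t\<bar> * (2 * c)" using c by (intro mult_left_mono) auto
      finally have right: "norm ((\<integral>\<omega>. iexp (t * Sinf \<omega>) \<partial>Q) - (\<integral>\<omega>. iexp (t * ?SQ \<omega>) \<partial>Q)) \<le> r / 3"
        using tc by linarith
      \<comment> \<open>The frequency \<open>t\<close> is absorbed into the coefficients, since the
        finite case is stated at frequency 1 for arbitrary coefficients.\<close>
      have "(\<lambda>j. \<integral>\<omega>. iexp (\<Sum>k\<in>G. (t * lam k) * T.tens_sum (nseq j) k \<omega>) \<partial>P)
          \<longlonglongrightarrow> (\<integral>\<omega>. iexp (\<Sum>k\<in>G. (t * lam k) * (\<Prod>s<d. \<beta> s (k s) \<omega>)) \<partial>Q)"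
        by (rule T.iexp_tens_sum_tendsto[OF N.gaussian_columns_axioms G n_lim])
      then have lim_G: "(\<lambda>j. \<integral>\<omega>. iexp (t * ?SG j \<omega>) \<partial>P) \<longlonglongrightarrow> (\<integral>\<omega>. iexp (t * ?SQ \<omega>) \<partial>Q)"
        by (simp only: sum_distrib_left mult.assoc)
      have "0 < r / 3" using r by simp
      with lim_G have mid: "\<forall>\<^sub>F j in sequentially.
          norm ((\<integral>\<omega>. iexp (t * ?SG j \<omega>) \<partial>P) - (\<integral>\<omega>. iexp (t * ?SQ \<omega>) \<partial>Q)) < r / 3"
        unfolding dist_norm[symmetric] by (rule tendstoD)
      show "\<forall>\<^sub>F j in sequentially.
          norm ((\<integral>\<omega>. iexp (t * ?S j \<omega>) \<partial>P) - (\<integral>\<omega>. iexp (t * Sinf \<omega>) \<partial>Q)) < r"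
        using n_pos mid
      proof eventually_elim
        case (elim j)
        have tri: "norm (u - z) \<le> norm (u - v) + norm (v - w) + norm (z - w)" for u v w z :: complex
          using norm_triangle_ineq4[of "(u - v) + (v - w)" "z - w"]
            norm_triangle_ineq[of "u - v" "v - w"] by simp
        show ?case
          using left[OF elim(1)] elim(2) right
            tri[of "\<integral>\<omega>. iexp (t * ?S j \<omega>) \<partial>P" "\<integral>\<omega>. iexp (t * Sinf \<omega>) \<partial>Q"
              "\<integral>\<omega>. iexp (t * ?SG j \<omega>) \<partial>P" "\<integral>\<omega>. iexp (t * ?SQ \<omega>) \<partial>Q"]
          by linarith
      qed
    qed
  qed
qed

end
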